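(* Let $m\ge1$ and $\xi_1,\xi_2\in\mathbb{R}$. For real $\tilde a<\tilde b$ let $$K_m^{\tilde a,\tilde b}(\xi_1;\xi_2)=\frac1{(2\pi i)^2}\int_{\Gamma_{\tilde a>}}d\omega\int_{\Gamma_{<\tilde b}}d\widetilde\omega\,\frac{e^{-\omega^3/3+\xi_2\omega}}{e^{-\widetilde\omega^3/3+\xi_1\widetilde\omega}}\,\frac{\left(\frac{\widetilde\omega-\tilde a}{\omega-\tilde a}\right)^m\left(\frac{\omega-\tilde b}{\widetilde\omega-\tilde b}\right)^m}{\omega-\widetilde\omega}.$$ By moving $\tilde a$ and $\tilde b$ in the complex plane from their original position $\tilde a<\tilde b$ to a new position $\tilde b<\tilde a$ on the real line, the kernel $K_m^{\tilde a,\tilde b}$ can be continued analytically in $(\tilde a,\tilde b)$ to the new kernel with the same integrand $$\widetilde K_m^{\tilde a,\tilde b}(\xi_1;\xi_2)=\frac1{(2\pi i)^2}\int_{\Omega}d\omega\int_{\widetilde\Omega}d\widetilde\omega\,\frac{e^{-\omega^3/3+\xi_2\omega}}{e^{-\widetilde\omega^3/3+\xi_1\widetilde\omega}}\,\frac{\left(\frac{\widetilde\omega-\tilde a}{\omega-\tilde a}\right)^m\left(\frac{\omega-\tilde b}{\widetilde\omega-\tilde b}\right)^m}{\omega-\widetilde\omega},\qquad \tilde b<\tilde a.$$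
   Context: Contours of $K_m^{\tilde a,\tilde b}$ ($\tilde a<\tilde b$): $\Gamma_{\tilde a>}$ goes from $e^{-2\pi i/3}\infty$ to $e^{2\pi i/3}\infty$ and passes to the right of $\tilde a$; $\Gamma_{<\tilde b}$ goes from $e^{\pi i/3}\infty$ to $e^{-\pi i/3}\infty$ and passes to the left of $\tilde b$; they do not intersect. Contours of $\widetilde K_m^{\tilde a,\tilde b}$ ($\tilde b<\tilde a$): $\Omega$ is the union of an infinite curve going from $e^{-2\pi i/3}\infty$ to $e^{2\pi i/3}\infty$ crossing the real axis between $\tilde b$ and $\tilde a$, and of a simple closed loop around $\tilde a$, oriented counterclockwise, not enclosing $\tilde b$; $\widetilde\Omega$ is the union of an infinite curve going from $e^{\pi i/3}\infty$ to $e^{-\pi i/3}\infty$ crossing the real axis between $\tilde b$ and $\tilde a$, and of a simple closed loop around $\tilde b$, oriented counterclockwise, not enclosing $\tilde a$. The four curves are pairwise disjoint (they may be allowed to touch at a single point of $(\tilde b,\tilde a)$) and from left to right they are: the loop around $\tilde b$, the infinite curve of $\Omega$, the infinite curve of $\widetilde\Omega$, the loop around $\tilde a$. *)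

theory Defs
  imports "HOL-Complex_Analysis.Complex_Analysis"
begin

text \<open>
  Analyticity in two complex variables: complex (Frechet) differentiability at every point of an
  open set, i.e. a derivative that is complex linear in the increment.
\<close>
definition holomorphic2_on :: "(complex \<times> complex \<Rightarrow> complex) \<Rightarrow> (complex \<times> complex) set \<Rightarrow> bool"
  where "holomorphic2_on F D \<longleftrightarrow> open D \<and>
    (\<forall>z\<in>D. \<exists>p q. (F has_derivative (\<lambda>(h, k). p * h + q * k)) (at z))"

text \<open>
  A simple, piecewise continuously differentiable curve going from \<open>u\<infinity>\<close> to \<open>v\<infinity>\<close>
  (with \<open>u\<close>, \<open>v\<close> of modulus 1). It is parametrised by the real line with bounded speed and
  \<open>\<bar>\<gamma> t\<bar> \<sim> \<bar>t\<bar>\<close> at both ends; this keeps the arc length under control, so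
  that the integrals below converge absolutely.
\<close>
definition infinite_curve :: "complex \<Rightarrow> complex \<Rightarrow> (real \<Rightarrow> complex) \<Rightarrow> bool"
  where "infinite_curve u v \<gamma> \<longleftrightarrow>
    inj \<gamma> \<and>
    (\<forall>T>0. \<gamma> piecewise_C1_differentiable_on {-T..T}) \<and>
    (\<exists>B. B-lipschitz_on UNIV \<gamma>) \<and>
    ((\<lambda>t. \<gamma> t / of_real \<bar>t\<bar>) \<longlongrightarrow> u) at_bot \<and>
    ((\<lambda>t. \<gamma> t / of_real \<bar>t\<bar>) \<longlongrightarrow> v) at_top"

definition infinite_contour_integral :: "(real \<Rightarrow> complex) \<Rightarrow> (complex \<Rightarrow> complex) \<Rightarrow> complex"
  where "infinite_contour_integral \<gamma> f =
    integral UNIV (\<lambda>t. f (\<gamma> t) * vector_derivative \<gamma> (at t))"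

text \<open>
  The points to the left (right) of an infinite curve are those in the component of the complement
  that contains the far negative (positive) real axis. Neither notion refers to the orientation.
\<close>
definition left_of :: "(real \<Rightarrow> complex) \<Rightarrow> complex set"
  where "left_of \<gamma> =
    {z. \<forall>\<^sub>F x in at_bot. connected_component (- range \<gamma>) z (complex_of_real x)}"

definition right_of :: "(real \<Rightarrow> complex) \<Rightarrow> complex set"
  where "right_of \<gamma> =
    {z. \<forall>\<^sub>F x in at_top. connected_component (- range \<gamma>) z (complex_of_real x)}"

definition crosses_between :: "real \<Rightarrow> real \<Rightarrow> (real \<Rightarrow> complex) \<Rightarrow> bool"
  where "crosses_between b a \<gamma> \<longleftrightarrow>
    (\<exists>x. b < x \<and> x < a \<and> complex_of_real x \<in> range \<gamma>) \<and>
    complex_of_real b \<in> left_of \<gamma> \<and> complex_of_real a \<in> right_of \<gamma>"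

definition loop_around :: "complex \<Rightarrow> complex \<Rightarrow> (real \<Rightarrow> complex) \<Rightarrow> bool"
  \<comment> \<open>counterclockwise around the first point, not enclosing the second\<close>
  where "loop_around p q l \<longleftrightarrow>
    valid_path l \<and> simple_path l \<and> pathfinish l = pathstart l \<and>
    p \<in> inside (path_image l) \<and> winding_number l p = 1 \<and> q \<in> outside (path_image l)"

definition integrand ::
  "nat \<Rightarrow> real \<Rightarrow> real \<Rightarrow> real \<Rightarrow> real \<Rightarrow> complex \<Rightarrow> complex \<Rightarrow> complex"
  where "integrand m \<xi>1 \<xi>2 a b z w =
    exp (- (z^3) / 3 + \<xi>2 * z) / exp (- (w^3) / 3 + \<xi>1 * w) *
    ((((w - a) / (z - a))^m * ((z - b) / (w - b))^m) / (z - w))"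

definition contours :: "real \<Rightarrow> real \<Rightarrow> (real \<Rightarrow> complex) \<Rightarrow> (real \<Rightarrow> complex) \<Rightarrow> bool"
  where "contours a b \<Gamma>a \<Gamma>b \<longleftrightarrow>
    infinite_curve (cis (- 2 * pi / 3)) (cis (2 * pi / 3)) \<Gamma>a \<and> complex_of_real a \<in> left_of \<Gamma>a \<and>
    infinite_curve (cis (pi / 3)) (cis (- pi / 3)) \<Gamma>b \<and> complex_of_real b \<in> right_of \<Gamma>b \<and>
    range \<Gamma>a \<inter> range \<Gamma>b = {}"

definition kernel_K ::
  "nat \<Rightarrow> real \<Rightarrow> real \<Rightarrow> real \<Rightarrow> real \<Rightarrow> (real \<Rightarrow> complex) \<Rightarrow> (real \<Rightarrow> complex) \<Rightarrow> complex"
  where "kernel_K m \<xi>1 \<xi>2 a b \<Gamma>a \<Gamma>b =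
    1 / (2 * complex_of_real pi * \<i>)^2 *
    infinite_contour_integral \<Gamma>a (\<lambda>z.
      infinite_contour_integral \<Gamma>b (\<lambda>w. integrand m \<xi>1 \<xi>2 a b z w))"

text \<open>
  Here \<open>L\<close> and \<open>la\<close> are the infinite curve and the loop of \<open>\<Omega>\<close>, and \<open>L'\<close> and \<open>lb\<close> those of the
  contour of the second variable. The point \<open>c\<close> is the only one at which the four curves may touch;
  they need not, so that the case of pairwise disjoint curves is included.
\<close>
definition contours_tilde ::
  "real \<Rightarrow> real \<Rightarrow> (real \<Rightarrow> complex) \<Rightarrow> (real \<Rightarrow> complex) \<Rightarrow> (real \<Rightarrow> complex) \<Rightarrow> (real \<Rightarrow> complex) \<Rightarrow> bool"
  where "contours_tilde a b L la L' lb \<longleftrightarrow>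
    infinite_curve (cis (- 2 * pi / 3)) (cis (2 * pi / 3)) L \<and> crosses_between b a L \<and>
    loop_around (complex_of_real a) (complex_of_real b) la \<and>
    infinite_curve (cis (pi / 3)) (cis (- pi / 3)) L' \<and> crosses_between b a L' \<and>
    loop_around (complex_of_real b) (complex_of_real a) lb \<and>
    (\<exists>c. b < c \<and> c < a \<and>
      range L \<inter> range L' \<subseteq> {complex_of_real c} \<and>
      range L \<inter> path_image la \<subseteq> {complex_of_real c} \<and>
      range L \<inter> path_image lb \<subseteq> {complex_of_real c} \<and>
      range L' \<inter> path_image la \<subseteq> {complex_of_real c} \<and>
      range L' \<inter> path_image lb \<subseteq> {complex_of_real c} \<and>
      path_image la \<inter> path_image lb \<subseteq> {complex_of_real c} \<and>
      path_image lb - {complex_of_real c} \<subseteq> left_of L \<and>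
      range L - {complex_of_real c} \<subseteq> left_of L' \<and>
      path_image la - {complex_of_real c} \<subseteq> right_of L')"

definition union_contour_integral ::
  "(real \<Rightarrow> complex) \<Rightarrow> (real \<Rightarrow> complex) \<Rightarrow> (complex \<Rightarrow> complex) \<Rightarrow> complex"
  where "union_contour_integral L l f = infinite_contour_integral L f + contour_integral l f"

text \<open>
  If the curves touch at \<open>c\<close>, the inner integral may fail to exist for the single value
  \<open>z = c\<close>, which does not affect the outer one.
\<close>
definition kernel_K_tilde ::
  "nat \<Rightarrow> real \<Rightarrow> real \<Rightarrow> real \<Rightarrow> real \<Rightarrow> (real \<Rightarrow> complex) \<Rightarrow> (real \<Rightarrow> complex) \<Rightarrow>
    (real \<Rightarrow> complex) \<Rightarrow> (real \<Rightarrow> complex) \<Rightarrow> complex"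
  where "kernel_K_tilde m \<xi>1 \<xi>2 a b L la L' lb =
    1 / (2 * complex_of_real pi * \<i>)^2 *
    union_contour_integral L la (\<lambda>z.
      union_contour_integral L' lb (\<lambda>w. integrand m \<xi>1 \<xi>2 a b z w))"

end

theory Submission
  imports Defs
begin

text \<open>
  The rational factor \<open>u = (w - a)(z - b) / ((z - a)(w - b))\<close> satisfies
  \<open>u = 1 + (b - a)(z - w) / ((z - a)(w - b))\<close>. Expanding \<open>u^m\<close> by the binomial theorem, the integrand
  becomes the Airy integrand, with factor \<open>1 / (z - w)\<close> and independent of \<open>a\<close> and \<open>b\<close>, plus a finite
  sum of products of a function of \<open>z\<close> with a pole at \<open>a\<close> only and a function of \<open>w\<close> with a pole at
  \<open>b\<close> only. The single integrals of these factors, over contours having \<open>a\<close> on their left and \<open>b\<close> on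
  their right, are entire functions of \<open>a\<close> and \<open>b\<close>; this gives the continuation. When the infinite
  curve passes on the other side of the pole, the loop contributes exactly the residue by which
  its integral differs from that entire function.

  For the Airy term no double integral has to be deformed: for \<open>z\<close> on one side of the inner curve the
  inner integral of \<open>1 / (z - w)\<close> is an entire function of \<open>z\<close>, bounded on a half-plane, so the outer
  integral does not depend on its curve and vanishes on the loop. The inner value is needed only
  for almost every \<open>z\<close>, which disposes of the point at which the contours may touch. The substitution
  \<open>w = - y\<close> reduces the contours of the second variable to those of the first.
\<close>

section \<open>Integrals along infinite curves\<close>

text \<open>The contours are arbitrary: their position is known only through connected components of
  complements, so no explicit homotopy between two of them is at hand. Curves are therefore compared
  one variable at a time. Both are cut off at the parameters \<open>-T\<close> and \<open>T\<close>,
  and the ends are joined by chords, which lie near \<open>T * cis (2 * pi / 3)\<close> and its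
  conjugate, where the integrand is at most a constant times \<open>exp (- T)\<close>. The pole has
  winding number zero once a connected unbounded set contains it, avoids both curves and is real far
  out, because the chords are not real. Explicit curves with one corner, the chevrons, serve as
  references, so that a nonzero winding number has to be computed only for a pair of
  chevrons.\<close>

definition tail_curve :: "(real \<Rightarrow> complex) \<Rightarrow> bool"
  where "tail_curve \<gamma> \<longleftrightarrow>
    (\<forall>T>0. \<gamma> piecewise_C1_differentiable_on {-T..T}) \<and>
    (\<exists>B. B-lipschitz_on UNIV \<gamma>) \<and>
    ((\<lambda>t. \<gamma> t / of_real \<bar>t\<bar>) \<longlongrightarrow> cis (- 2 * pi / 3)) at_bot \<and>
    ((\<lambda>t. \<gamma> t / of_real \<bar>t\<bar>) \<longlongrightarrow> cis (2 * pi / 3)) at_top"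

lemma infinite_curve_imp_tail_curve:
  "infinite_curve (cis (- 2 * pi / 3)) (cis (2 * pi / 3)) \<gamma> \<Longrightarrow> tail_curve \<gamma>"
  by (simp add: infinite_curve_def tail_curve_def)

text \<open>The radius grows linearly with \<open>T\<close>, because convergence of
  \<open>\<gamma> t / \<bar>t\<bar>\<close> to a direction controls \<open>\<gamma> t\<close> only
  up to an error \<open>o(t)\<close>.\<close>

definition near :: "complex \<Rightarrow> real \<Rightarrow> real \<Rightarrow> complex set"
  where "near u \<epsilon> T = cball (of_real T * u) (\<epsilon> * T)"

text \<open>A condition on the two asymptotic directions alone, so that functions with poles
  qualify. The rate \<open>exp (- T)\<close> is far weaker than cubic decay but already yields an
  integrable majorant.\<close>

definition decays :: "(complex \<Rightarrow> complex) \<Rightarrow> bool"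
  where "decays f \<longleftrightarrow> (\<exists>\<epsilon>>0. \<exists>C. \<forall>\<^sub>F T in at_top.
    \<forall>z \<in> near (cis (2 * pi / 3)) \<epsilon> T \<union> near (cis (- 2 * pi / 3)) \<epsilon> T. norm (f z) \<le> C * exp (- T))"

lemma near_of_quotient:
  assumes "t \<noteq> 0" "dist (g / of_real \<bar>t\<bar>) u < \<epsilon>"
  shows "g \<in> near u \<epsilon> \<bar>t\<bar>"
proof -
  have "norm (of_real \<bar>t\<bar> * u - g) = \<bar>t\<bar> * norm (g / of_real \<bar>t\<bar> - u)"
  proof -
    have "of_real \<bar>t\<bar> * u - g = of_real \<bar>t\<bar> * (u - g / of_real \<bar>t\<bar>)"
      using assms(1) by (simp add: field_simps)
    then show ?thesis by (simp add: norm_mult norm_minus_commute)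
  qed
  also have "\<dots> \<le> \<bar>t\<bar> * \<epsilon>"
    using assms by (intro mult_left_mono) (auto simp: dist_norm)
  finally show ?thesis by (simp add: near_def dist_norm mult.commute)
qed

lemma tail_curve_near:
  assumes "tail_curve \<gamma>" "\<epsilon> > 0"
  shows "\<exists>T0>0. \<forall>t\<ge>T0. \<gamma> t \<in> near (cis (2 * pi / 3)) \<epsilon> t \<and> \<gamma> (-t) \<in> near (cis (- 2 * pi / 3)) \<epsilon> t"
proof -
  have "\<forall>\<^sub>F t in at_top. dist (\<gamma> t / of_real \<bar>t\<bar>) (cis (2 * pi / 3)) < \<epsilon>"
    and "\<forall>\<^sub>F t in at_bot. dist (\<gamma> t / of_real \<bar>t\<bar>) (cis (- 2 * pi / 3)) < \<epsilon>"
    using assms by (auto simp: tail_curve_def tendsto_iff)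
  then obtain a b where a: "\<And>t. t \<ge> a \<Longrightarrow> dist (\<gamma> t / of_real \<bar>t\<bar>) (cis (2 * pi / 3)) < \<epsilon>"
    and b: "\<And>t. t \<le> b \<Longrightarrow> dist (\<gamma> t / of_real \<bar>t\<bar>) (cis (- 2 * pi / 3)) < \<epsilon>"
    unfolding eventually_at_top_linorder eventually_at_bot_linorder by metis
  show ?thesis
  proof (intro exI[of _ "max 1 (max a (-b))"] conjI allI impI)
    fix t assume t: "max 1 (max a (-b)) \<le> t"
    then have "t \<noteq> 0" "\<bar>t\<bar> = t" "-t \<le> b" "a \<le> t" by auto
    then show "\<gamma> t \<in> near (cis (2 * pi / 3)) \<epsilon> t" "\<gamma> (-t) \<in> near (cis (- 2 * pi / 3)) \<epsilon> t"
      using near_of_quotient[OF _ a, of t] near_of_quotient[OF _ b, of "-t"] by auto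
  qed auto
qed

text \<open>Difference quotients are bounded by the Lipschitz constant. This bounded speed turns
  decay of \<open>f\<close> along a contour into an integrable majorant for the contour
  integral.\<close>

lemma lipschitz_vector_derivative_bound:
  fixes f :: "real \<Rightarrow> 'a::real_normed_vector"
  assumes "B-lipschitz_on UNIV f" "f differentiable (at t)"
  shows "norm (vector_derivative f (at t)) \<le> B"
proof -
  let ?D = "vector_derivative f (at t)"
  have "(f has_vector_derivative ?D) (at t)"
    using assms(2) vector_derivative_works by blast
  then have "((\<lambda>h. norm (f (t + h) - f t - h *\<^sub>R ?D) / norm h) \<longlongrightarrow> 0) (at 0)"
    by (simp add: has_vector_derivative_def has_derivative_at)
  moreover have "\<forall>\<^sub>F h in at 0. norm ?D - B \<le> norm (f (t + h) - f t - h *\<^sub>R ?D) / norm h"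
  proof (rule eventually_at_filter[THEN iffD2], rule always_eventually, intro allI impI)
    fix h :: real assume "h \<noteq> 0"
    have "dist (f (t + h)) (f t) \<le> B * dist (t + h) t"
      using assms(1) by (rule lipschitz_onD) auto
    then have "norm (f (t + h) - f t) \<le> B * \<bar>h\<bar>"
      by (simp add: dist_norm)
    moreover have "norm (h *\<^sub>R ?D) \<le> norm (f (t + h) - f t) + norm (f (t + h) - f t - h *\<^sub>R ?D)"
      by (metis norm_minus_commute norm_triangle_sub)
    ultimately have "(norm ?D - B) * \<bar>h\<bar> \<le> norm (f (t + h) - f t - h *\<^sub>R ?D)"
      by (simp add: algebra_simps)
    then show "norm ?D - B \<le> norm (f (t + h) - f t - h *\<^sub>R ?D) / norm h"
      using \<open>h \<noteq> 0\<close> by (simp add: pos_le_divide_eq)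
  qed
  ultimately have "norm ?D - B \<le> 0"
    by (intro tendsto_le[OF _ _ tendsto_const]) auto
  then show ?thesis by simp
qed

lemma subpath_tail_curve:
  assumes "tail_curve \<gamma>" "T > 0"
  shows "valid_path (subpath (-T) T \<gamma>)"
    and "path_image (subpath (-T) T \<gamma>) = \<gamma> ` {-T..T}"
proof -
  have im: "(\<lambda>x. (2 * T) * x + (-T)) ` {0..1} = {-T..T}"
    using assms image_affinity_atLeastAtMost[of "2*T" "-T" 0 1] by (simp add: algebra_simps)
  then have "(\<gamma> \<circ> (\<lambda>x. (2 * T) *\<^sub>R x + (-T))) piecewise_C1_differentiable_on {0..1}"
    by (intro piecewise_C1_differentiable_affine) (use assms in \<open>auto simp: tail_curve_def\<close>)
  then show "valid_path (subpath (-T) T \<gamma>)"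
    by (simp add: valid_path_def subpath_def o_def algebra_simps)
  show "path_image (subpath (-T) T \<gamma>) = \<gamma> ` {-T..T}"
    using assms by (simp add: path_image_def subpath_def image_image algebra_simps flip: im)
qed

lemma tail_curve_differentiable:
  assumes "tail_curve \<gamma>" "T > 0"
  obtains S where "finite S" "\<And>t. t \<in> {-T..T} - S \<Longrightarrow> \<gamma> differentiable (at t)"
  using assms unfolding tail_curve_def piecewise_C1_differentiable_on_def C1_differentiable_on_eq by metis

lemma tail_curve_negligible:
  assumes \<gamma>: "tail_curve \<gamma>"
  shows "negligible {t. \<not> \<gamma> differentiable (at t)}"
proof -
  define X where "X = {t. \<not> \<gamma> differentiable (at t)}"
  have "countable X"
  proof -
    have "\<exists>F. finite F \<and> X \<inter> {- real (Suc n)..real (Suc n)} \<subseteq> F" for n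
    proof -
      obtain F where "finite F" "\<And>t. t \<in> {- real (Suc n)..real (Suc n)} - F \<Longrightarrow> \<gamma> differentiable (at t)"
        using tail_curve_differentiable[OF \<gamma>, of "real (Suc n)"] by auto
      then show ?thesis unfolding X_def by blast
    qed
    then have "countable (\<Union>n. X \<inter> {- real (Suc n)..real (Suc n)})"
      by (intro countable_UN) (meson countable_finite countableI_type finite_subset)+
    moreover have "X \<subseteq> (\<Union>n. X \<inter> {- real (Suc n)..real (Suc n)})"
    proof
      fix t assume "t \<in> X"
      obtain n where "\<bar>t\<bar> \<le> real n" using real_arch_simple by blast
      then show "t \<in> (\<Union>n. X \<inter> {- real (Suc n)..real (Suc n)})"
        using \<open>t \<in> X\<close> by (intro UN_I[of n]) auto
    qed
    ultimately show ?thesis using countable_subset by blast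
  qed
  then have "negligible X"
    by (simp add: negligible_iff_null_sets null_sets_completionI countable_imp_null_set_lborel)
  then show ?thesis by (simp add: X_def)
qed

text \<open>Bridge between library contour integrals, over paths parametrised by
  \<open>{0..1}\<close>, and integrals over \<open>{-T..T}\<close>. The substitution is
  \<open>t = 2 * T * x - T\<close>; the finitely many corners are spiked out.\<close>

lemma has_integral_subpath:
  assumes \<gamma>: "tail_curve \<gamma>" and T: "T > 0"
    and f: "f contour_integrable_on (subpath (-T) T \<gamma>)"
  shows "((\<lambda>t. f (\<gamma> t) * vector_derivative \<gamma> (at t)) has_integral
      contour_integral (subpath (-T) T \<gamma>) f) {-T..T}"
proof -
  obtain S where S: "finite S" "\<And>t. t \<in> {-T..T} - S \<Longrightarrow> \<gamma> differentiable (at t)"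
    using tail_curve_differentiable[OF \<gamma> T] by metis
  have vd: "vector_derivative (\<lambda>x. \<gamma> ((2*T) * x - T)) (at x) = (2*T) *\<^sub>R vector_derivative \<gamma> (at ((2*T) * x - T))"
    if "x \<in> {0..1}" "x \<notin> (\<lambda>x. (2*T) * x - T) -` S" for x
  proof (rule vector_derivative_at [OF vector_diff_chain_at [simplified o_def]])
    show "((\<lambda>x. (2*T) * x - T) has_vector_derivative 2*T) (at x)"
      by (intro derivative_eq_intros | simp)+
    have "(2*T) * x - T \<in> {-T..T} - S" using that T by (auto simp: mult_left_le)
    then show "(\<gamma> has_vector_derivative vector_derivative \<gamma> (at ((2*T) * x - T))) (at ((2*T) * x - T))"
      using S vector_derivative_works by blast
  qed
  have fin: "finite ((\<lambda>x. (2*T) * x - T) -` S)"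
    using S T by (auto simp: inj_on_def finite_vimageI)
  let ?h = "\<lambda>t. f (\<gamma> t) * vector_derivative \<gamma> (at t)"
  have sp: "subpath (-T) T \<gamma> = (\<lambda>x. \<gamma> ((2*T) * x - T))"
    by (simp add: subpath_def)
  have "((\<lambda>x. f (subpath (-T) T \<gamma> x) * vector_derivative (subpath (-T) T \<gamma>) (at x)) has_integral
      contour_integral (subpath (-T) T \<gamma>) f) {0..1}"
    using has_contour_integral_integral[OF f] by (simp add: has_contour_integral)
  then have "((\<lambda>x. (2*T) *\<^sub>R ?h ((2*T) * x - T)) has_integral
      contour_integral (subpath (-T) T \<gamma>) f) {0..1}"
    unfolding sp by (rule has_integral_spike_finite[OF fin, rotated]) (simp add: vd scaleR_conv_of_real)
  then have "((\<lambda>x. (1/(2*T)) *\<^sub>R (2*T) *\<^sub>R ?h ((2*T) * x - T)) has_integral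
      (1/(2*T)) *\<^sub>R contour_integral (subpath (-T) T \<gamma>) f) {0..1}"
    by (rule has_integral_cmul)
  then have "((\<lambda>x. ?h ((2*T) *\<^sub>R x + (-T))) has_integral
      contour_integral (subpath (-T) T \<gamma>) f /\<^sub>R (2*T) ^ DIM(real)) (cbox ((-T - -T) /\<^sub>R (2*T)) ((T - -T) /\<^sub>R (2*T)))"
    using T by (simp add: inverse_eq_divide)
  then show ?thesis
    using T by (subst (asm) has_integral_affinity_iff) auto
qed

lemma exp_abs_integrable: "(\<lambda>t::real. exp (- \<bar>t\<bar>)) integrable_on UNIV"
proof -
  have "(\<lambda>t::real. exp (- t)) absolutely_integrable_on {0..}"
    using integrable_on_exp_minus_to_infinity[of 1 0]
    by (intro nonnegative_absolutely_integrable_1) auto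
  then have p: "(\<lambda>t::real. exp (- \<bar>t\<bar>)) absolutely_integrable_on {0..}"
    by (rule absolutely_integrable_spike[of _ _ "{}"]) auto
  have "uminus ` {..0::real} = {0..}" by (force intro: image_eqI[of _ _ "- _"])
  then have "(\<lambda>t::real. exp (- \<bar>- t\<bar>)) absolutely_integrable_on {..0}"
    using has_absolute_integral_reflect_real[of "{..0}" "{0..}" "\<lambda>t. exp (- \<bar>t\<bar>)"] p by auto
  then have "(\<lambda>t::real. exp (- \<bar>t\<bar>)) absolutely_integrable_on ({..0} \<union> {0..})"
    using p by (intro absolutely_integrable_Un) auto
  moreover have "{..0} \<union> {0..} = (UNIV :: real set)" by auto
  ultimately show ?thesis
    by (simp add: absolutely_integrable_on_def)
qed

text \<open>The mass of the majorant lost by truncation; up to a constant it bounds the truncation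
  error of every integrand considered. \<open>Suc n\<close> keeps the cut-off positive, as
  \<open>subpath_tail_curve\<close> requires.\<close>

definition exp_tail :: "nat \<Rightarrow> real"
  where "exp_tail n = integral UNIV (\<lambda>t. if \<bar>t\<bar> \<le> real (Suc n) then 0 else exp (- \<bar>t\<bar>))"

lemma exp_tail_integrable:
  "(\<lambda>t::real. if \<bar>t\<bar> \<le> real (Suc n) then 0 else exp (- \<bar>t\<bar>)) integrable_on UNIV"
proof -
  have "(\<lambda>t::real. if t \<in> {- real (Suc n)..real (Suc n)} then exp (- \<bar>t\<bar>) else 0) integrable_on UNIV"
    by (subst integrable_restrict_UNIV) (intro integrable_continuous_real continuous_intros)
  from integrable_diff[OF exp_abs_integrable this] show ?thesis
    by (rule integrable_eq) auto
qed

lemma exp_tail_tendsto: "exp_tail \<longlonglongrightarrow> 0"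
proof -
  have "(\<lambda>n. integral UNIV (\<lambda>t. if \<bar>t\<bar> \<le> real (Suc n) then 0 else exp (- \<bar>t\<bar>))) \<longlonglongrightarrow>
      integral UNIV (\<lambda>t::real. 0::real)"
  proof (rule dominated_convergence(2)[OF exp_tail_integrable exp_abs_integrable])
    fix t :: real
    obtain N where "\<bar>t\<bar> \<le> real N" using real_arch_simple by blast
    then have "\<forall>n\<ge>N. (if \<bar>t\<bar> \<le> real (Suc n) then 0 else exp (- \<bar>t\<bar>)) = 0"
      by auto
    then have "\<forall>\<^sub>F n in sequentially. (if \<bar>t\<bar> \<le> real (Suc n) then 0 else exp (- \<bar>t\<bar>)) = 0"
      unfolding eventually_sequentially by blast
    then show "(\<lambda>n. if \<bar>t\<bar> \<le> real (Suc n) then 0 else exp (- \<bar>t\<bar>)) \<longlonglongrightarrow> 0"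
      by (rule tendsto_eventually)
  qed auto
  then show ?thesis by (simp add: exp_tail_def[abs_def])
qed

lemma tail_curve_continuous: "tail_curve \<gamma> \<Longrightarrow> continuous_on S \<gamma>"
  unfolding tail_curve_def by (meson continuous_on_subset lipschitz_on_continuous_on subset_UNIV)

lemma decays_along:
  assumes \<gamma>: "tail_curve \<gamma>" and dec: "decays f" and cont: "continuous_on (range \<gamma>) f"
  obtains C where "\<And>t. norm (f (\<gamma> t)) \<le> C * exp (- \<bar>t\<bar>)"
proof -
  have contf: "continuous_on UNIV (\<lambda>t. f (\<gamma> t))"
    by (rule continuous_on_compose2[OF cont tail_curve_continuous[OF \<gamma>]]) simp
  obtain \<epsilon> C1 where \<epsilon>: "\<epsilon> > 0" and "\<forall>\<^sub>F T in at_top. \<forall>z \<in> near (cis (2 * pi / 3)) \<epsilon> T \<union>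
    near (cis (- 2 * pi / 3)) \<epsilon> T. norm (f z) \<le> C1 * exp (- T)"
    using dec unfolding decays_def by blast
  then obtain T1 where T1: "\<And>T z. T \<ge> T1 \<Longrightarrow> z \<in> near (cis (2 * pi / 3)) \<epsilon> T \<union>
    near (cis (- 2 * pi / 3)) \<epsilon> T \<Longrightarrow> norm (f z) \<le> C1 * exp (- T)"
    unfolding eventually_at_top_linorder by blast
  obtain T2 where T2: "T2 > 0" "\<And>t. t \<ge> T2 \<Longrightarrow> \<gamma> t \<in> near (cis (2 * pi / 3)) \<epsilon> t \<and> \<gamma> (-t) \<in> near (cis (- 2 * pi / 3)) \<epsilon> t"
    using tail_curve_near[OF \<gamma> \<epsilon>] by blast
  define T0 where "T0 = max T1 T2"
  have "compact ((\<lambda>t. f (\<gamma> t)) ` {-T0..T0})"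
    by (intro compact_continuous_image continuous_on_subset[OF contf]) auto
  then obtain C2 where "\<forall>x \<in> (\<lambda>t. f (\<gamma> t)) ` {-T0..T0}. norm x \<le> C2"
    using compact_imp_bounded bounded_iff by meson
  then have C2: "norm (f (\<gamma> t)) \<le> C2" if "t \<in> {-T0..T0}" for t
    using that by blast
  \<comment> \<open>On the compact middle part \<open>exp (- \<bar>t\<bar>)\<close> is at least
    \<open>exp (- T0)\<close>, which the factor \<open>exp T0\<close> compensates.\<close>
  define C where "C = max C1 (\<bar>C2\<bar> * exp T0)"
  show ?thesis
  proof (rule that[of C])
    fix t
    show "norm (f (\<gamma> t)) \<le> C * exp (- \<bar>t\<bar>)"
    proof (cases "t \<in> {-T0..T0}")
      case True
      have "norm (f (\<gamma> t)) \<le> \<bar>C2\<bar> * 1" using C2[OF True] by simp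
      also have "\<dots> \<le> \<bar>C2\<bar> * (exp T0 * exp (- \<bar>t\<bar>))"
        using True by (intro mult_left_mono) (auto simp: simp flip: exp_add)
      also have "\<dots> = (\<bar>C2\<bar> * exp T0) * exp (- \<bar>t\<bar>)" by simp
      also have "\<dots> \<le> C * exp (- \<bar>t\<bar>)"
        by (intro mult_right_mono) (auto simp: C_def)
      finally show ?thesis .
    next
      case False
      then have t: "\<bar>t\<bar> \<ge> T1" "\<bar>t\<bar> \<ge> T2" by (auto simp: T0_def)
      have "\<gamma> t \<in> near (cis (2 * pi / 3)) \<epsilon> \<bar>t\<bar> \<union> near (cis (- 2 * pi / 3)) \<epsilon> \<bar>t\<bar>"
        using T2(2)[OF t(2)] by (cases "t \<ge> 0") auto
      then have "norm (f (\<gamma> t)) \<le> C1 * exp (- \<bar>t\<bar>)" by (rule T1[OF t(1)])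
      also have "\<dots> \<le> C * exp (- \<bar>t\<bar>)"
        by (intro mult_right_mono) (auto simp: C_def)
      finally show ?thesis .
    qed
  qed
qed

text \<open>Dominated convergence with a multiple of \<open>exp (- \<bar>t\<bar>)\<close> as
  majorant. The last two claims hold for every admissible \<open>C\<close>, so that a constant
  common to a family of integrands gives bounds uniform in the family.\<close>

lemma infinite_integral_limit:
  assumes \<gamma>: "tail_curve \<gamma>" and dec: "decays f"
    and hol: "f holomorphic_on S" and S: "open S" "range \<gamma> \<subseteq> S"
    and B: "B-lipschitz_on UNIV \<gamma>"
  shows "(\<lambda>t. f (\<gamma> t) * vector_derivative \<gamma> (at t)) integrable_on UNIV"
    and "(\<lambda>n. contour_integral (subpath (- real (Suc n)) (real (Suc n)) \<gamma>) f)
      \<longlonglongrightarrow> infinite_contour_integral \<gamma> f"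
    and "\<And>C. (\<And>t. norm (f (\<gamma> t)) \<le> C * exp (- \<bar>t\<bar>)) \<Longrightarrow>
      norm (infinite_contour_integral \<gamma> f) \<le> C * B * integral UNIV (\<lambda>t. exp (- \<bar>t\<bar>))"
    and "\<And>C n. (\<And>t. norm (f (\<gamma> t)) \<le> C * exp (- \<bar>t\<bar>)) \<Longrightarrow>
      norm (contour_integral (subpath (- real (Suc n)) (real (Suc n)) \<gamma>) f - infinite_contour_integral \<gamma> f)
        \<le> C * B * exp_tail n"
proof -
  have B0: "B \<ge> 0" using B by (rule lipschitz_on_nonneg)
  define X where "X = {t. \<not> \<gamma> differentiable (at t)}"
  have negl: "negligible X" unfolding X_def by (rule tail_curve_negligible[OF \<gamma>])
  \<comment> \<open>At a corner \<open>vector_derivative\<close> is an unspecified value. Resetting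
    it to 0 there makes the speed bound \<open>B\<close> hold at every \<open>t\<close>, at the cost
    of a negligible set.\<close>
  define D where "D t = (if t \<in> X then 0 else vector_derivative \<gamma> (at t))" for t
  have D: "norm (D t) \<le> B" for t
    using lipschitz_vector_derivative_bound[OF B] B0 by (auto simp: D_def X_def)
  obtain C where C: "\<And>t. norm (f (\<gamma> t)) \<le> C * exp (- \<bar>t\<bar>)"
    using decays_along[OF \<gamma> dec] holomorphic_on_imp_continuous_on[OF hol] S(2) continuous_on_subset by metis
  have C0: "C \<ge> 0" using order_trans[OF norm_ge_zero C[of 0]] by simp
  define g where "g n t = (if t \<in> {- real (Suc n)..real (Suc n)} then f (\<gamma> t) * D t else 0)" for n t
  have int: "(g n has_integral contour_integral (subpath (- real (Suc n)) (real (Suc n)) \<gamma>) f) UNIV" for n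
  proof -
    have "path_image (subpath (- real (Suc n)) (real (Suc n)) \<gamma>) \<subseteq> S"
      using S(2) subpath_tail_curve(2)[OF \<gamma>, of "real (Suc n)"] by auto
    then have "f contour_integrable_on (subpath (- real (Suc n)) (real (Suc n)) \<gamma>)"
      by (intro contour_integrable_holomorphic_simple[OF hol S(1) subpath_tail_curve(1)[OF \<gamma>]]) simp_all
    then have "((\<lambda>t. f (\<gamma> t) * vector_derivative \<gamma> (at t)) has_integral
      contour_integral (subpath (- real (Suc n)) (real (Suc n)) \<gamma>) f) {- real (Suc n)..real (Suc n)}"
      by (intro has_integral_subpath[OF \<gamma>]) auto
    then have "((\<lambda>t. f (\<gamma> t) * D t) has_integral
      contour_integral (subpath (- real (Suc n)) (real (Suc n)) \<gamma>) f) {- real (Suc n)..real (Suc n)}"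
      by (rule has_integral_spike[OF negl, rotated]) (auto simp: D_def)
    then show ?thesis
      unfolding g_def by (subst has_integral_restrict_UNIV) 
  qed
  have i: "integral UNIV (g n) = contour_integral (subpath (- real (Suc n)) (real (Suc n)) \<gamma>) f" for n
    using int by (rule integral_unique)
  have bd: "norm (g n t) \<le> (C * B) * exp (- \<bar>t\<bar>)" for n t
  proof -
    have "norm (g n t) \<le> norm (f (\<gamma> t)) * norm (D t)" by (auto simp: g_def norm_mult)
    also have "\<dots> \<le> (C * exp (- \<bar>t\<bar>)) * B"
      using C D C0 by (intro mult_mono) auto
    finally show ?thesis by (simp add: algebra_simps)
  qed
  have lim: "(\<lambda>n. g n t) \<longlonglongrightarrow> f (\<gamma> t) * D t" for t
  proof (rule tendsto_eventually)
    obtain N where "\<bar>t\<bar> \<le> real N" using real_arch_simple by blast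
    then have "\<forall>n\<ge>N. g n t = f (\<gamma> t) * D t"
      by (auto simp: g_def)
    then show "\<forall>\<^sub>F n in sequentially. g n t = f (\<gamma> t) * D t"
      unfolding eventually_sequentially by blast
  qed
  have gi: "g n integrable_on UNIV" for n using int by blast
  have hi: "(\<lambda>t. (C * B) * exp (- \<bar>t\<bar>)) integrable_on UNIV"
    using exp_abs_integrable by (rule integrable_on_mult_right)
  note dc = dominated_convergence[OF gi hi bd lim]
  have eq: "integral UNIV (\<lambda>t. f (\<gamma> t) * D t) = infinite_contour_integral \<gamma> f"
    unfolding infinite_contour_integral_def
    by (rule integral_spike[OF negl]) (auto simp: D_def)
  show "(\<lambda>t. f (\<gamma> t) * vector_derivative \<gamma> (at t)) integrable_on UNIV"
    by (rule integrable_spike[OF dc(1) negl]) (auto simp: D_def)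
  show "(\<lambda>n. contour_integral (subpath (- real (Suc n)) (real (Suc n)) \<gamma>) f)
      \<longlonglongrightarrow> infinite_contour_integral \<gamma> f"
    using dc(2) by (simp only: i eq)
  fix C' assume C': "\<And>t. norm (f (\<gamma> t)) \<le> C' * exp (- \<bar>t\<bar>)"
  then have C'0: "C' \<ge> 0" using order_trans[OF norm_ge_zero C'[of 0]] by simp
  have fD: "norm (f (\<gamma> t) * D t) \<le> (C' * B) * exp (- \<bar>t\<bar>)" for t
    using mult_mono[OF C' D] C'0 by (simp add: norm_mult algebra_simps)
  have "norm (integral UNIV (\<lambda>t. f (\<gamma> t) * D t)) \<le> integral UNIV (\<lambda>t. (C' * B) * exp (- \<bar>t\<bar>))"
    using fD by (intro integral_norm_bound_integral dc(1) integrable_on_mult_right exp_abs_integrable)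
  then show "norm (infinite_contour_integral \<gamma> f) \<le> C' * B * integral UNIV (\<lambda>t. exp (- \<bar>t\<bar>))"
    by (simp add: eq)
  fix n
  have "norm (integral UNIV (\<lambda>t. g n t - f (\<gamma> t) * D t)) \<le>
      integral UNIV (\<lambda>t. (C' * B) * (if \<bar>t\<bar> \<le> real (Suc n) then 0 else exp (- \<bar>t\<bar>)))"
  proof (intro integral_norm_bound_integral integrable_diff gi dc(1) integrable_on_mult_right exp_tail_integrable)
    show "norm (g n t - f (\<gamma> t) * D t) \<le> (C' * B) * (if \<bar>t\<bar> \<le> real (Suc n) then 0 else exp (- \<bar>t\<bar>))" for t
      using fD[of t] by (auto simp: g_def)
  qed
  then show "norm (contour_integral (subpath (- real (Suc n)) (real (Suc n)) \<gamma>) f - infinite_contour_integral \<gamma> f)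
        \<le> C' * B * exp_tail n"
    using i[of n] eq by (simp add: integral_diff gi dc(1) exp_tail_def)
qed

section \<open>Comparison of infinite contours\<close>

lemma cis_120: "cis (2 * pi / 3) = Complex (-1/2) (sqrt 3 / 2)"
  "cis (- 2 * pi / 3) = Complex (-1/2) (- sqrt 3 / 2)"
  using cos_120 sin_120 by (auto simp: complex_eq_iff)

text \<open>The two rays from the vertex \<open>r\<close> in the directions of the contours at
  infinity, run at unit speed with the corner at \<open>t = 0\<close>. The vertex is the only real
  point.\<close>

definition chevron :: "real \<Rightarrow> real \<Rightarrow> complex"
  where "chevron r t = Complex (r - \<bar>t\<bar> / 2) (sqrt 3 / 2 * t)"

lemma chevron_alt:
  "t \<ge> 0 \<Longrightarrow> chevron r t = of_real r + of_real t * cis (2 * pi / 3)"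
  "t \<le> 0 \<Longrightarrow> chevron r t = of_real r + of_real (-t) * cis (- 2 * pi / 3)"
  unfolding cis_120 by (auto simp: complex_eq_iff chevron_def)

lemma tail_curve_chevron: "tail_curve (chevron r)"
proof -
  have lip: "2-lipschitz_on UNIV (chevron r)"
  proof (rule lipschitz_onI)
    fix x y :: real
    have "norm (chevron r x - chevron r y) \<le> \<bar>Re (chevron r x - chevron r y)\<bar> + \<bar>Im (chevron r x - chevron r y)\<bar>"
      by (rule cmod_le)
    also have "\<dots> \<le> \<bar>x - y\<bar> / 2 + sqrt 3 / 2 * \<bar>x - y\<bar>"
    proof (intro add_mono)
      show "\<bar>Re (chevron r x - chevron r y)\<bar> \<le> \<bar>x - y\<bar> / 2"
        using abs_triangle_ineq3[of y x] by (simp add: chevron_def abs_minus_commute flip: diff_divide_distrib)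
      show "\<bar>Im (chevron r x - chevron r y)\<bar> \<le> sqrt 3 / 2 * \<bar>x - y\<bar>"
        by (simp add: chevron_def abs_mult flip: right_diff_distrib diff_divide_distrib)
    qed
    also have "\<dots> \<le> \<bar>x - y\<bar> / 2 + 1 * \<bar>x - y\<bar>"
      by (intro add_left_mono mult_right_mono) (auto intro: real_le_lsqrt)
    also have "\<dots> \<le> 2 * \<bar>x - y\<bar>" by simp
    finally show "dist (chevron r x) (chevron r y) \<le> 2 * dist x y"
      unfolding dist_norm real_norm_def .
  qed auto
  have der: "(chevron r has_vector_derivative (Complex (- sgn t / 2) (sqrt 3 / 2))) (at t)" if "t \<noteq> 0" for t
  proof (cases "t > 0")
    case True
    have "((\<lambda>t. of_real r + of_real t * cis (2 * pi / 3)) has_vector_derivative cis (2 * pi / 3)) (at t)"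
      by (auto intro!: derivative_eq_intros)
    then have "((\<lambda>t. of_real r + of_real t * cis (2 * pi / 3)) has_vector_derivative Complex (- sgn t / 2) (sqrt 3 / 2)) (at t)"
      using True by (simp add: cis_120)
    then show ?thesis
      by (rule has_vector_derivative_transform_within_open[of _ _ _ "{0<..}"]) (use True in \<open>auto simp: chevron_alt\<close>)
  next
    case False
    then have "t < 0" using that by simp
    have "((\<lambda>t. of_real r + of_real (-t) * cis (- 2 * pi / 3)) has_vector_derivative - cis (- 2 * pi / 3)) (at t)"
      by (auto intro!: derivative_eq_intros)
    then have "((\<lambda>t. of_real r + of_real (-t) * cis (- 2 * pi / 3)) has_vector_derivative Complex (- sgn t / 2) (sqrt 3 / 2)) (at t)"
      using \<open>t < 0\<close> unfolding cis_120 by (simp add: complex_minus)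
    then show ?thesis
      by (rule has_vector_derivative_transform_within_open[of _ _ _ "{..<0}"]) (use \<open>t < 0\<close> chevron_alt in auto)
  qed
  have "chevron r piecewise_C1_differentiable_on {-T..T}" for T
    unfolding piecewise_C1_differentiable_on_def
  proof (intro conjI exI[of _ "{0}"])
    show "continuous_on {-T..T} (chevron r)"
      using lipschitz_on_continuous_on[OF lip] continuous_on_subset by blast
    show "chevron r C1_differentiable_on {-T..T} - {0}"
      unfolding C1_differentiable_on_def
    proof (intro exI[of _ "\<lambda>t. Complex (- sgn t / 2) (sqrt 3 / 2)"] conjI ballI)
      show "continuous_on ({- T..T} - {0}) (\<lambda>t. Complex (- sgn t / 2) (sqrt 3 / 2))"
        by (intro continuous_intros) auto
    qed (use der in auto)
  qed auto
  moreover have "((\<lambda>t. chevron r t / of_real \<bar>t\<bar>) \<longlongrightarrow> cis (- 2 * pi / 3)) at_bot"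
  proof -
    have "((\<lambda>t::real. of_real (r / (-t)) + cis (- 2 * pi / 3)) \<longlongrightarrow> of_real 0 + cis (- 2 * pi / 3)) at_bot"
      by (intro tendsto_intros real_tendsto_divide_at_top[OF tendsto_const] filterlim_uminus_at_top_at_bot)
    then have "((\<lambda>t::real. of_real (r / (-t)) + cis (- 2 * pi / 3)) \<longlongrightarrow> cis (- 2 * pi / 3)) at_bot"
      by simp
    then show ?thesis
      by (rule Lim_transform_eventually)
        (rule eventually_mono[OF eventually_le_at_bot[of "-1"]], subst chevron_alt(2), auto simp: field_simps)
  qed
  moreover have "((\<lambda>t. chevron r t / of_real \<bar>t\<bar>) \<longlongrightarrow> cis (2 * pi / 3)) at_top"
  proof -
    have "((\<lambda>t::real. of_real (r / t) + cis (2 * pi / 3)) \<longlongrightarrow> of_real 0 + cis (2 * pi / 3)) at_top"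
      by (intro tendsto_intros real_tendsto_divide_at_top[OF tendsto_const] filterlim_ident)
    then have "((\<lambda>t::real. of_real (r / t) + cis (2 * pi / 3)) \<longlongrightarrow> cis (2 * pi / 3)) at_top"
      by simp
    then show ?thesis
      by (rule Lim_transform_eventually)
        (rule eventually_mono[OF eventually_gt_at_top[of 0]], subst chevron_alt(1), auto simp: field_simps)
  qed
  ultimately show ?thesis
    unfolding tail_curve_def using lip by blast
qed

lemma near_norm: "z \<in> near (cis \<theta>) \<epsilon> T \<Longrightarrow> 0 \<le> T \<Longrightarrow> norm z \<ge> (1 - \<epsilon>) * T \<and> norm z \<le> (1 + \<epsilon>) * T"
  using norm_triangle_ineq2[of "of_real T * cis \<theta>" "of_real T * cis \<theta> - z"]
    norm_triangle_ineq2[of z "z - of_real T * cis \<theta>"]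
  by (auto simp: near_def dist_norm norm_mult norm_minus_commute algebra_simps)

text \<open>Both directions have imaginary part of modulus \<open>sqrt 3 / 2\<close>, more than the
  relative radius \<open>1/2\<close>. This keeps the chords near infinity off the real half-lines
  used to locate poles.\<close>

lemma near_nonreal:
  assumes "z \<in> near (cis (2 * pi / 3)) \<epsilon> T \<union> near (cis (- 2 * pi / 3)) \<epsilon> T" "T > 0" "\<epsilon> \<le> 1/2"
  shows "z \<notin> \<real>"
proof
  assume "z \<in> \<real>"
  have "sqrt 3 / 2 * T \<le> \<epsilon> * T"
    using assms(1)
  proof
    assume "z \<in> near (cis (2 * pi / 3)) \<epsilon> T"
    then have "\<bar>Im (of_real T * cis (2 * pi / 3) - z)\<bar> \<le> \<epsilon> * T"
      using abs_Im_le_cmod order_trans unfolding near_def mem_cball dist_norm by blast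
    then show ?thesis using \<open>z \<in> \<real>\<close> assms(2) unfolding cis_120 by (simp add: complex_is_Real_iff)
  next
    assume "z \<in> near (cis (- 2 * pi / 3)) \<epsilon> T"
    then have "\<bar>Im (of_real T * cis (- 2 * pi / 3) - z)\<bar> \<le> \<epsilon> * T"
      using abs_Im_le_cmod order_trans unfolding near_def mem_cball dist_norm by blast
    then show ?thesis using \<open>z \<in> \<real>\<close> assms(2) unfolding cis_120 by (simp add: complex_is_Real_iff)
  qed
  moreover have "sqrt 3 > 1" by simp
  ultimately show False using assms(2,3) by simp
qed

lemma near_Re:
  assumes "z \<in> near (cis (2 * pi / 3)) \<epsilon> T \<union> near (cis (- 2 * pi / 3)) \<epsilon> T"
  shows "Re z \<le> (\<epsilon> - 1/2) * T"
proof -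
  have "Re z \<le> (\<epsilon> - 1/2) * T" if "norm (of_real T * u - z) \<le> \<epsilon> * T" "Re u = -1/2" for u
    using abs_Re_le_cmod[of "of_real T * u - z"] that by (simp add: algebra_simps)
  then show ?thesis
    using assms unfolding near_def mem_cball dist_norm Un_iff cis_120 by (metis complex.sel(1))
qed

lemma near_mono: "\<epsilon> \<le> \<epsilon>' \<Longrightarrow> 0 \<le> T \<Longrightarrow> near u \<epsilon> T \<subseteq> near u \<epsilon>' T"
  unfolding near_def by (intro subset_cball mult_right_mono)

section \<open>Sides of a curve and sets reaching infinity\<close>

lemma tail_curve_closed_range:
  assumes "tail_curve \<gamma>"
  shows "closed (range \<gamma>)"
proof -
  obtain T where T: "T > 0" "\<And>t. t \<ge> T \<Longrightarrow> \<gamma> t \<in> near (cis (2 * pi / 3)) (1/2) t \<and> \<gamma> (-t) \<in> near (cis (- 2 * pi / 3)) (1/2) t"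
    using tail_curve_near[OF assms, of "1/2"] by auto
  have big: "norm (\<gamma> t) \<ge> \<bar>t\<bar> / 2" if "\<bar>t\<bar> \<ge> T" for t
  proof -
    have "\<gamma> t \<in> near (cis (2 * pi / 3)) (1/2) \<bar>t\<bar> \<or> \<gamma> t \<in> near (cis (- 2 * pi / 3)) (1/2) \<bar>t\<bar>"
      using T(2)[OF that] by (cases "t \<ge> 0") auto
    then have "(1 - 1/2) * \<bar>t\<bar> \<le> norm (\<gamma> t)"
      by (meson abs_ge_zero near_norm)
    then show ?thesis by simp
  qed
  have "l \<in> range \<gamma>" if "l \<in> closure (range \<gamma>)" for l
  proof -
    \<comment> \<open>\<open>big\<close> gives
      \<open>\<bar>t\<bar> / 2 \<le> norm (\<gamma> t) \<le> norm l + 1\<close> for large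
      \<open>\<bar>t\<bar>\<close>, so points of the curve near \<open>l\<close> have parameters in
      \<open>{-M..M}\<close>.\<close>
    define M where "M = 2 * norm l + 2 + T"
    have "l \<in> closure (\<gamma> ` {-M..M})"
      unfolding closure_approachable
    proof (intro allI impI)
      fix e :: real assume "e > 0"
      then have "\<exists>y\<in>range \<gamma>. dist y l < min e 1"
        using that unfolding closure_approachable by (metis min_less_iff_conj zero_less_one)
      then obtain t where t: "dist (\<gamma> t) l < min e 1"
        by blast
      have "norm (\<gamma> t) \<le> norm l + 1"
        using t norm_triangle_ineq2[of "\<gamma> t" l] by (simp add: dist_norm)
      then have "\<bar>t\<bar> \<le> M" using big[of t] T(1) norm_ge_zero[of l] unfolding M_def by linarith
      then show "\<exists>y\<in>\<gamma> ` {-M..M}. dist y l < e" using t by (intro bexI[of _ "\<gamma> t"] imageI) auto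
    qed
    moreover have "closed (\<gamma> ` {-M..M})"
      using tail_curve_continuous[OF assms] by (intro compact_imp_closed compact_continuous_image) auto
    ultimately show ?thesis by auto
  qed
  then have "closure (range \<gamma>) \<subseteq> range \<gamma>" by blast
  then show ?thesis by (simp add: closure_subset_eq)
qed

text \<open>
  With \<open>s = 1\<close> (\<open>s = -1\<close>) the point \<open>p\<close> lies to the right (left) of the curve; the connecting set is
  bounded up to the half-line, which makes it avoid all distant nonreal points.
\<close>
definition reaches :: "real \<Rightarrow> (real \<Rightarrow> complex) \<Rightarrow> complex \<Rightarrow> bool"
  where "reaches s \<gamma> p \<longleftrightarrow> (\<exists>U R. connected U \<and> p \<in> U \<and> U \<inter> range \<gamma> = {} \<and>
    (\<forall>r\<ge>R. of_real (s * r) \<in> U) \<and> (\<forall>z\<in>U. norm z > R \<longrightarrow> (\<exists>r>0. z = of_real (s * r))))"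

text \<open>A connected set that witnesses the component may be unbounded in an uncontrolled way.
  The range is closed, so its complement is open and components are path components: a path to one
  point of the half-line has compact image, and the half-line itself lies in the complement.\<close>

lemma reachesI:
  assumes \<gamma>: "tail_curve \<gamma>" and s: "s = 1 \<or> s = -1"
    and conn: "\<And>x. x \<ge> N \<Longrightarrow> connected_component (- range \<gamma>) p (of_real (s * x))"
  shows "reaches s \<gamma> p"
proof -
  have op: "open (- range \<gamma>)" using tail_curve_closed_range[OF \<gamma>] by (rule open_Compl)
  have "path_component (- range \<gamma>) p (of_real (s * N))"
    using conn[of N] path_component_eq_connected_component[OF open_imp_locally_path_connected[OF op]] by simp
  then obtain g where g: "path g" "path_image g \<subseteq> - range \<gamma>" "pathstart g = p" "pathfinish g = of_real (s * N)"
    unfolding path_component_def by blast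
  obtain B where B: "\<And>z. z \<in> path_image g \<Longrightarrow> norm z \<le> B"
    using bounded_path_image[OF g(1)] bounded_iff by blast
  define L where "L = (\<lambda>x. complex_of_real (s * x)) ` {N..}"
  have cL: "connected L"
    unfolding L_def by (intro connected_continuous_image continuous_intros) auto
  show ?thesis
    unfolding reaches_def
  proof (rule exI, rule exI, intro conjI allI impI ballI)
    show "connected (path_image g \<union> L)"
    proof (rule connected_Un[OF connected_path_image[OF g(1)] cL])
      have "of_real (s * N) \<in> path_image g" using g(4) pathfinish_in_path_image by metis
      moreover have "of_real (s * N) \<in> L" unfolding L_def by blast
      ultimately show "path_image g \<inter> L \<noteq> {}" by blast
    qed
    show "p \<in> path_image g \<union> L" using pathstart_in_path_image[of g] g(3) by simp
    show "(path_image g \<union> L) \<inter> range \<gamma> = {}"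
    proof -
      have "L \<subseteq> - range \<gamma>"
        using connected_component_in[OF conn, THEN conjunct2] unfolding L_def by auto
      then show ?thesis using g by blast
    qed
    show "of_real (s * r) \<in> path_image g \<union> L" if "r \<ge> max \<bar>N\<bar> B" for r
      using that by (auto simp: L_def)
    show "\<exists>r>0. z = complex_of_real (s * r)" if "z \<in> path_image g \<union> L" "norm z > max \<bar>N\<bar> B" for z
    proof -
      have "z \<in> L" using that B by fastforce
      then obtain x where x: "x \<ge> N" "z = of_real (s * x)" by (auto simp: L_def)
      then have "\<bar>x\<bar> > \<bar>N\<bar>" using that(2) s by (auto simp: norm_mult)
      then show ?thesis using x by (intro exI[of _ x]) auto
    qed
  qed
qed

lemma left_of_imp_reaches:
  assumes "tail_curve \<gamma>" "p \<in> left_of \<gamma>"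
  shows "reaches (-1) \<gamma> p"
proof -
  obtain N where "\<And>x. x \<le> N \<Longrightarrow> connected_component (- range \<gamma>) p (of_real x)"
    using assms(2) unfolding left_of_def eventually_at_bot_linorder by blast
  then have "connected_component (- range \<gamma>) p (of_real ((-1) * x))" if "x \<ge> -N" for x
    using that by (metis minus_le_iff mult_minus1)
  then show ?thesis by (intro reachesI[OF assms(1), of _ "-N"]) auto
qed

lemma right_of_imp_reaches:
  assumes "tail_curve \<gamma>" "p \<in> right_of \<gamma>"
  shows "reaches 1 \<gamma> p"
proof -
  obtain N where "\<And>x. x \<ge> N \<Longrightarrow> connected_component (- range \<gamma>) p (of_real x)"
    using assms(2) unfolding right_of_def eventually_at_top_linorder by blast
  then show ?thesis by (intro reachesI[OF assms(1), of _ N]) auto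
qed

text \<open>Completing the square shows that a distant vertex pushes the whole chevron, not only its
  tip, away from the origin.\<close>

lemma chevron_norm: "norm (chevron r t) \<ge> \<bar>r\<bar> / 2"
proof -
  have "(r - \<bar>t\<bar> / 2)\<^sup>2 + (sqrt 3 / 2 * t)\<^sup>2 = (\<bar>t\<bar> - r / 2)\<^sup>2 + 3 / 4 * r\<^sup>2"
    by (simp add: power2_eq_square algebra_simps)
  also have "\<dots> \<ge> (\<bar>r\<bar> / 2)\<^sup>2" by (simp add: power2_eq_square)
  finally show ?thesis
    unfolding chevron_def complex_norm by (rule real_le_rsqrt)
qed

lemma chevron_real: "chevron r t \<in> \<real> \<longleftrightarrow> t = 0" "chevron r 0 = of_real r"
  by (auto simp: chevron_def complex_is_Real_iff complex_of_real_def)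

lemma reaches_segment:
  assumes s: "s = 1 \<or> s = -1"
    and seg: "closed_segment 0 p \<inter> range \<gamma> = {}" and ray: "\<And>x. x \<ge> 0 \<Longrightarrow> of_real (s * x) \<notin> range \<gamma>"
  shows "reaches s \<gamma> p"
proof -
  define L where "L = (\<lambda>x. complex_of_real (s * x)) ` {0..}"
  have cL: "connected L"
    unfolding L_def by (intro connected_continuous_image continuous_intros) auto
  show ?thesis
    unfolding reaches_def
  proof (rule exI, rule exI, intro conjI allI impI ballI)
    show "connected (closed_segment 0 p \<union> L)"
    proof (rule connected_Un[OF connected_segment cL])
      have "0 \<in> L" unfolding L_def by (intro image_eqI[of _ _ 0]) auto
      then show "closed_segment 0 p \<inter> L \<noteq> {}" by auto
    qed
    show "p \<in> closed_segment 0 p \<union> L" by auto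
    show "of_real (s * r) \<in> closed_segment 0 p \<union> L" if "r \<ge> norm p" for r
      using order_trans[OF norm_ge_zero that] unfolding L_def by blast
    show "\<exists>r>0. z = complex_of_real (s * r)" if "z \<in> closed_segment 0 p \<union> L" "norm z > norm p" for z
    proof -
      have "z \<in> L" using that segment_bound(1)[of z 0 p] by auto
      then obtain x where x: "x \<ge> 0" "z = of_real (s * x)" unfolding L_def by blast
      moreover have "x \<noteq> 0" using that x norm_ge_zero[of p] by auto
      ultimately show ?thesis by (intro exI[of _ x]) auto
    qed
    show "(closed_segment 0 p \<union> L) \<inter> range \<gamma> = {}"
      using seg ray unfolding L_def by blast
  qed
qed

text \<open>The chevron stays at distance at least \<open>Y / 2 > norm p\<close> from 0, hence
  misses the segment from 0 to \<open>p\<close>, and its vertex \<open>- s * Y\<close> is opposite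
  to the half-line in direction \<open>s\<close>.\<close>

lemma reaches_chevron:
  assumes s: "s = 1 \<or> s = -1" and Y: "Y \<ge> 2 * norm p + 1"
  shows "reaches s (chevron (- s * Y)) p"
proof (rule reaches_segment[OF s])
  have Y0: "Y > 0" using Y norm_ge_zero[of p] by linarith
  have "\<bar>- s * Y\<bar> = Y" using s Y0 by auto
  then have "chevron (- s * Y) t \<notin> closed_segment 0 p" for t
    using segment_bound(1)[of "chevron (- s * Y) t" 0 p] chevron_norm[of "- s * Y" t] Y by fastforce
  then show "closed_segment 0 p \<inter> range (chevron (- s * Y)) = {}" by blast
  fix x :: real assume "x \<ge> 0"
  show "of_real (s * x) \<notin> range (chevron (- s * Y))"
  proof
    assume "of_real (s * x) \<in> range (chevron (- s * Y))"
    then obtain t where t: "of_real (s * x) = chevron (- s * Y) t" by blast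
    then have "t = 0" using chevron_real(1)[of "- s * Y" t] by (metis Reals_of_real)
    then have "s * x = - s * Y" using t chevron_real(2)[of "- s * Y"] by (metis of_real_eq_iff)
    then show False using \<open>x \<ge> 0\<close> Y0 s by auto
  qed
qed

section \<open>Closing up two curves by chords\<close>

definition closed_up :: "(real \<Rightarrow> complex) \<Rightarrow> (real \<Rightarrow> complex) \<Rightarrow> real \<Rightarrow> real \<Rightarrow> complex"
  where "closed_up \<gamma> \<delta> T = subpath (-T) T \<gamma> +++ linepath (\<gamma> T) (\<delta> T) +++
    reversepath (subpath (-T) T \<delta>) +++ linepath (\<delta> (-T)) (\<gamma> (-T))"

lemma subpath_ends: "pathstart (subpath u v g) = g u" "pathfinish (subpath u v g) = g v"
  by (auto simp: subpath_def pathstart_def pathfinish_def)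

lemma closed_up:
  assumes "tail_curve \<gamma>" "tail_curve \<delta>" "T > 0"
  shows "valid_path (closed_up \<gamma> \<delta> T)" "pathfinish (closed_up \<gamma> \<delta> T) = pathstart (closed_up \<gamma> \<delta> T)"
    and "path_image (closed_up \<gamma> \<delta> T) \<subseteq>
      range \<gamma> \<union> range \<delta> \<union> closed_segment (\<gamma> T) (\<delta> T) \<union> closed_segment (\<gamma> (-T)) (\<delta> (-T))"
proof -
  show "valid_path (closed_up \<gamma> \<delta> T)"
    unfolding closed_up_def
    by (intro valid_path_join subpath_tail_curve assms valid_path_linepath valid_path_imp_reverse)
      (simp_all add: subpath_ends)
  show "pathfinish (closed_up \<gamma> \<delta> T) = pathstart (closed_up \<gamma> \<delta> T)"
    by (simp add: closed_up_def subpath_ends)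
  show "path_image (closed_up \<gamma> \<delta> T) \<subseteq>
      range \<gamma> \<union> range \<delta> \<union> closed_segment (\<gamma> T) (\<delta> T) \<union> closed_segment (\<gamma> (-T)) (\<delta> (-T))"
    using subpath_tail_curve(2)[OF assms(1,3)] subpath_tail_curve(2)[OF assms(2,3)]
    by (auto simp: closed_up_def path_image_join subpath_ends closed_segment_commute)
qed

lemma contour_integral_closed_up:
  assumes "tail_curve \<gamma>" "tail_curve \<delta>" "T > 0" and f: "f holomorphic_on S" "open S"
    and im: "range \<gamma> \<subseteq> S" "range \<delta> \<subseteq> S" "closed_segment (\<gamma> T) (\<delta> T) \<subseteq> S"
      "closed_segment (\<gamma> (-T)) (\<delta> (-T)) \<subseteq> S"
  shows "contour_integral (closed_up \<gamma> \<delta> T) f =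
    contour_integral (subpath (-T) T \<gamma>) f - contour_integral (subpath (-T) T \<delta>) f +
    (contour_integral (linepath (\<gamma> T) (\<delta> T)) f + contour_integral (linepath (\<delta> (-T)) (\<gamma> (-T))) f)"
proof -
  note vp = subpath_tail_curve(1)[OF assms(1,3)] subpath_tail_curve(1)[OF assms(2,3)]
  have pi: "path_image (subpath (-T) T \<gamma>) \<subseteq> S" "path_image (subpath (-T) T \<delta>) \<subseteq> S"
    using subpath_tail_curve(2)[OF assms(1,3)] subpath_tail_curve(2)[OF assms(2,3)] im by auto
  note ci = contour_integrable_holomorphic_simple[OF f]
  have ints: "f contour_integrable_on subpath (-T) T \<gamma>" "f contour_integrable_on subpath (-T) T \<delta>"
    "f contour_integrable_on linepath (\<gamma> T) (\<delta> T)" "f contour_integrable_on linepath (\<delta> (-T)) (\<gamma> (-T))"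
    using im pi vp by (auto intro!: ci simp: closed_segment_commute)
  then have "f contour_integrable_on reversepath (subpath (-T) T \<delta>)"
    using vp contour_integrable_reversepath by blast
  then show ?thesis
    using ints vp unfolding closed_up_def
    by (simp add: contour_integrable_joinI valid_path_join subpath_ends contour_integral_reversepath)
qed

lemma segments_near:
  assumes "tail_curve \<gamma>" "tail_curve \<delta>" "\<epsilon> > 0"
  shows "\<forall>\<^sub>F T in at_top. closed_segment (\<gamma> T) (\<delta> T) \<subseteq> near (cis (2 * pi / 3)) \<epsilon> T \<and>
    closed_segment (\<gamma> (-T)) (\<delta> (-T)) \<subseteq> near (cis (- 2 * pi / 3)) \<epsilon> T"
proof -
  obtain T1 T2 where T: "\<And>t. t \<ge> T1 \<Longrightarrow> \<gamma> t \<in> near (cis (2 * pi / 3)) \<epsilon> t \<and> \<gamma> (-t) \<in> near (cis (- 2 * pi / 3)) \<epsilon> t"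
    "\<And>t. t \<ge> T2 \<Longrightarrow> \<delta> t \<in> near (cis (2 * pi / 3)) \<epsilon> t \<and> \<delta> (-t) \<in> near (cis (- 2 * pi / 3)) \<epsilon> t"
    using tail_curve_near[OF assms(1,3)] tail_curve_near[OF assms(2,3)] by blast
  have cv: "convex (near u \<epsilon> t)" for u t by (simp add: near_def)
  show ?thesis
    unfolding eventually_at_top_linorder
  proof (intro exI[of _ "max T1 T2"] allI impI conjI)
    fix t assume "max T1 T2 \<le> t"
    then have t: "T1 \<le> t" "T2 \<le> t" by auto
    show "closed_segment (\<gamma> t) (\<delta> t) \<subseteq> near (cis (2 * pi / 3)) \<epsilon> t"
      "closed_segment (\<gamma> (-t)) (\<delta> (-t)) \<subseteq> near (cis (- 2 * pi / 3)) \<epsilon> t"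
      using T(1)[OF t(1)] T(2)[OF t(2)] closed_segment_subset[OF _ _ cv] by auto
  qed
qed


text \<open>As \<open>\<delta>\<close> is traversed backwards, the closed path carries the
  difference of the two integrals plus the chords. A chord at \<open>T\<close> contributes at most
  \<open>C * exp (- T) * (2 * T)\<close>, which tends to 0.\<close>

lemma closed_up_limit:
  assumes \<gamma>: "tail_curve \<gamma>" and \<delta>: "tail_curve \<delta>" and dec: "decays f" and f: "f holomorphic_on -P"
    and P: "finite P" "range \<gamma> \<inter> P = {}" "range \<delta> \<inter> P = {}"
  shows "(\<lambda>n. contour_integral (closed_up \<gamma> \<delta> (real (Suc n))) f) \<longlonglongrightarrow>
    infinite_contour_integral \<gamma> f - infinite_contour_integral \<delta> f"
    and "\<forall>\<^sub>F n in sequentially. path_image (closed_up \<gamma> \<delta> (real (Suc n))) \<subseteq> -P"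
proof -
  have opP: "open (-P)" using P(1) by (simp add: finite_imp_closed open_Compl)
  have im: "range \<gamma> \<subseteq> -P" "range \<delta> \<subseteq> -P" using P by auto
  obtain \<epsilon> C T1 where \<epsilon>: "\<epsilon> > 0" and C: "\<And>T z. T \<ge> T1 \<Longrightarrow> z \<in> near (cis (2 * pi / 3)) \<epsilon> T \<union>
      near (cis (- 2 * pi / 3)) \<epsilon> T \<Longrightarrow> norm (f z) \<le> C * exp (- T)"
    using dec unfolding decays_def eventually_at_top_linorder by blast
  \<comment> \<open>Relative radius at most \<open>1/2\<close> keeps the discs at modulus at least
    \<open>T / 2\<close>, hence off the bounded set \<open>P\<close> once
    \<open>T > 2 * M\<close>.\<close>
  define \<eta> where "\<eta> = min \<epsilon> (1/2)"
  have \<eta>: "\<eta> > 0" "\<eta> \<le> \<epsilon>" "\<eta> \<le> 1/2" using \<epsilon> by (auto simp: \<eta>_def)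
  obtain M where M: "\<And>p. p \<in> P \<Longrightarrow> norm p \<le> M"
    using finite_imp_bounded[OF P(1)] bounded_iff by blast
  obtain T2 where T2: "\<And>T. T \<ge> T2 \<Longrightarrow> closed_segment (\<gamma> T) (\<delta> T) \<subseteq> near (cis (2 * pi / 3)) \<eta> T \<and>
    closed_segment (\<gamma> (-T)) (\<delta> (-T)) \<subseteq> near (cis (- 2 * pi / 3)) \<eta> T"
    using segments_near[OF \<gamma> \<delta> \<eta>(1)] unfolding eventually_at_top_linorder by blast
  obtain B1 B2 where B: "B1-lipschitz_on UNIV \<gamma>" "B2-lipschitz_on UNIV \<delta>"
    using \<gamma> \<delta> unfolding tail_curve_def by blast
  define L where "L T = contour_integral (linepath (\<gamma> T) (\<delta> T)) f + contour_integral (linepath (\<delta> (-T)) (\<gamma> (-T))) f" for T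
  define T0 where "T0 = max 1 (max T1 (max T2 (2 * M + 1)))"
  have seg: "closed_segment (\<gamma> T) (\<delta> T) \<subseteq> near (cis (2 * pi / 3)) \<eta> T \<and> closed_segment (\<gamma> T) (\<delta> T) \<subseteq> -P"
    "closed_segment (\<gamma> (-T)) (\<delta> (-T)) \<subseteq> near (cis (- 2 * pi / 3)) \<eta> T \<and> closed_segment (\<gamma> (-T)) (\<delta> (-T)) \<subseteq> -P"
    if "T \<ge> T0" for T
  proof -
    have T: "T \<ge> T1" "T \<ge> T2" "T > 2 * M" "T \<ge> 1" using that by (auto simp: T0_def)
    have "near (cis \<theta>) \<eta> T \<subseteq> -P" for \<theta>
    proof
      fix z assume z: "z \<in> near (cis \<theta>) \<eta> T"
      have "(1/2) * T \<le> (1 - \<eta>) * T" using T \<eta> by (intro mult_right_mono) auto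
      then have "norm z > M" using near_norm[OF z] T by linarith
      then show "z \<in> - P" using M by force
    qed
    then show "closed_segment (\<gamma> T) (\<delta> T) \<subseteq> near (cis (2 * pi / 3)) \<eta> T \<and> closed_segment (\<gamma> T) (\<delta> T) \<subseteq> -P"
      "closed_segment (\<gamma> (-T)) (\<delta> (-T)) \<subseteq> near (cis (- 2 * pi / 3)) \<eta> T \<and> closed_segment (\<gamma> (-T)) (\<delta> (-T)) \<subseteq> -P"
      using T2[OF T(2)] by blast+
  qed
  have lb: "norm (contour_integral (linepath a b) f) \<le> C * exp (-T) * (2 * T)"
    if "T \<ge> T0" and ab: "closed_segment a b \<subseteq> near u \<eta> T" "closed_segment a b \<subseteq> -P" and u: "u = cis (2 * pi / 3) \<or> u = cis (- 2 * pi / 3)" for a b u T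
  proof -
    have T: "T \<ge> T1" "T \<ge> 1" using that by (auto simp: T0_def)
    have fb: "norm (f z) \<le> C * exp (-T)" if "z \<in> closed_segment a b" for z
      using C[OF T(1)] near_mono[OF \<eta>(2), of T] ab that u T(2) by (meson UnCI order_trans subsetD zero_le_one)
    have C0: "0 \<le> C * exp (-T)" using order_trans[OF norm_ge_zero fb[of a]] by simp
    have "a \<in> near u \<eta> T" "b \<in> near u \<eta> T" using ab by auto
    then have "dist a b \<le> \<eta> * T + \<eta> * T"
      unfolding near_def mem_cball by (metis add_mono dist_commute dist_triangle_le)
    also have "\<dots> \<le> 2 * T" using \<eta> T by (simp add: mult_le_cancel_right1 flip: distrib_right)
    finally have "norm (b - a) \<le> 2 * T" by (simp add: dist_norm norm_minus_commute)
    have "f contour_integrable_on linepath a b"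
      using ab by (intro contour_integrable_holomorphic_simple[OF f opP]) auto
    then have "norm (contour_integral (linepath a b) f) \<le> C * exp (-T) * norm (b - a)"
      using C0 fb by (rule contour_integral_bound_linepath)
    also have "\<dots> \<le> C * exp (-T) * (2 * T)"
      using C0 \<open>norm (b - a) \<le> 2 * T\<close> by (intro mult_left_mono)
    finally show ?thesis .
  qed
  have "(L \<longlongrightarrow> 0) at_top"
  proof (rule Lim_null_comparison)
    show "\<forall>\<^sub>F T in at_top. norm (L T) \<le> 4 * C * (T / exp T)"
      unfolding eventually_at_top_linorder
    proof (intro exI[of _ T0] allI impI)
      fix T assume "T \<ge> T0"
      note s = seg[OF \<open>T \<ge> T0\<close>]
      have "norm (L T) \<le> C * exp (-T) * (2 * T) + C * exp (-T) * (2 * T)"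
        unfolding L_def
      proof (rule norm_triangle_mono)
        show "norm (contour_integral (linepath (\<gamma> T) (\<delta> T)) f) \<le> C * exp (-T) * (2 * T)"
          using s(1) by (intro lb[OF \<open>T \<ge> T0\<close>, of _ _ "cis (2 * pi / 3)"]) auto
        show "norm (contour_integral (linepath (\<delta> (-T)) (\<gamma> (-T))) f) \<le> C * exp (-T) * (2 * T)"
          using s(2) by (intro lb[OF \<open>T \<ge> T0\<close>, of _ _ "cis (- 2 * pi / 3)"]) (auto simp: closed_segment_commute)
      qed
      then show "norm (L T) \<le> 4 * C * (T / exp T)" by (simp add: exp_minus field_simps)
    qed
    show "((\<lambda>T. 4 * C * (T / exp T)) \<longlongrightarrow> 0) at_top"
      by (intro tendsto_mult_right_zero tendsto_power_div_exp_0[of 1, simplified])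
  qed
  moreover have rl: "filterlim (\<lambda>n. real (Suc n)) at_top sequentially"
    by (intro filterlim_compose[OF filterlim_real_sequentially filterlim_Suc])
  ultimately have L0: "(\<lambda>n. L (real (Suc n))) \<longlonglongrightarrow> 0"
    by (rule filterlim_compose)
  have ev: "\<forall>\<^sub>F n in sequentially. real (Suc n) \<ge> T0"
    using rl unfolding filterlim_at_top by blast
  have "(\<lambda>n. contour_integral (subpath (- real (Suc n)) (real (Suc n)) \<gamma>) f -
      contour_integral (subpath (- real (Suc n)) (real (Suc n)) \<delta>) f + L (real (Suc n)))
      \<longlonglongrightarrow> infinite_contour_integral \<gamma> f - infinite_contour_integral \<delta> f + 0"
    by (intro tendsto_intros L0 infinite_integral_limit(2)[OF \<gamma> dec f opP im(1) B(1)] infinite_integral_limit(2)[OF \<delta> dec f opP im(2) B(2)])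
  then have lim: "(\<lambda>n. contour_integral (subpath (- real (Suc n)) (real (Suc n)) \<gamma>) f -
      contour_integral (subpath (- real (Suc n)) (real (Suc n)) \<delta>) f + L (real (Suc n)))
      \<longlonglongrightarrow> infinite_contour_integral \<gamma> f - infinite_contour_integral \<delta> f" by simp
  show "(\<lambda>n. contour_integral (closed_up \<gamma> \<delta> (real (Suc n))) f) \<longlonglongrightarrow>
    infinite_contour_integral \<gamma> f - infinite_contour_integral \<delta> f"
  proof (rule Lim_transform_eventually[OF lim])
    show "\<forall>\<^sub>F n in sequentially. contour_integral (subpath (- real (Suc n)) (real (Suc n)) \<gamma>) f -
      contour_integral (subpath (- real (Suc n)) (real (Suc n)) \<delta>) f + L (real (Suc n)) =
      contour_integral (closed_up \<gamma> \<delta> (real (Suc n))) f"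
      using ev
    proof eventually_elim
      case (elim n)
      then show ?case
        using contour_integral_closed_up[OF \<gamma> \<delta> _ f opP im, of "real (Suc n)"] seg[of "real (Suc n)"]
        by (simp add: L_def)
    qed
  qed
  show "\<forall>\<^sub>F n in sequentially. path_image (closed_up \<gamma> \<delta> (real (Suc n))) \<subseteq> -P"
    using ev
  proof eventually_elim
    case (elim n)
    have "(0::real) < real (Suc n)" by simp
    from closed_up(3)[OF \<gamma> \<delta> this] seg[OF elim] im show ?case by blast
  qed
qed

text \<open>The set \<open>U\<close> puts \<open>p\<close> into an unbounded component of the
  complement of the closed-up path: it avoids both curves, and beyond \<open>R\<close> it is real
  whereas the chords are not. So all winding numbers about \<open>P\<close> eventually vanish, and
  Cauchy's theorem applies.\<close>

lemma infinite_integral_eqI: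
  assumes \<gamma>: "tail_curve \<gamma>" and \<delta>: "tail_curve \<delta>" and dec: "decays f" and f: "f holomorphic_on -P"
    and P: "finite P" "range \<gamma> \<inter> P = {}" "range \<delta> \<inter> P = {}"
    and sep: "\<And>p. p \<in> P \<Longrightarrow> \<exists>U R. connected U \<and> p \<in> U \<and> U \<inter> range \<gamma> = {} \<and> U \<inter> range \<delta> = {} \<and>
      \<not> bounded U \<and> (\<forall>z\<in>U. norm z > R \<longrightarrow> z \<in> \<real>)"
  shows "infinite_contour_integral \<gamma> f = infinite_contour_integral \<delta> f"
proof -
  have opP: "open (-P)" using P(1) by (simp add: finite_imp_closed open_Compl)
  have rl: "filterlim (\<lambda>n. real (Suc n)) at_top sequentially"
    by (intro filterlim_compose[OF filterlim_real_sequentially filterlim_Suc])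
  have w: "\<forall>\<^sub>F n in sequentially. winding_number (closed_up \<gamma> \<delta> (real (Suc n))) p = 0" if p: "p \<in> P" for p
  proof -
    obtain U R where U: "connected U" "p \<in> U" "U \<inter> range \<gamma> = {}" "U \<inter> range \<delta> = {}"
      "\<not> bounded U" "\<And>z. z\<in>U \<Longrightarrow> norm z > R \<Longrightarrow> z \<in> \<real>"
      using sep[OF p] by blast
    have "\<forall>\<^sub>F T in at_top. closed_segment (\<gamma> T) (\<delta> T) \<subseteq> near (cis (2 * pi / 3)) (1/2) T \<and>
        closed_segment (\<gamma> (-T)) (\<delta> (-T)) \<subseteq> near (cis (- 2 * pi / 3)) (1/2) T"
      using segments_near[OF \<gamma> \<delta>, of "1/2"] by simp
    then have "\<forall>\<^sub>F T in at_top. winding_number (closed_up \<gamma> \<delta> T) p = 0"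
      \<comment> \<open>Chord points have modulus at least \<open>T / 2\<close>, so
        \<open>T > 2 * R\<close> places them where \<open>U\<close> contains only real
        points.\<close>
      using eventually_gt_at_top[of "max 1 (2 * R)"]
    proof eventually_elim
      case (elim T)
      then have T: "T > 0" "T > 2 * R" by auto
      have nearU: "z \<notin> U" if z: "z \<in> near (cis (2 * pi / 3)) (1/2) T \<union> near (cis (- 2 * pi / 3)) (1/2) T" for z
      proof -
        have "norm z \<ge> (1 - 1/2) * T" using z near_norm T by (metis Un_iff less_imp_le)
        then have "norm z > R" using T by simp
        then show ?thesis using U(6) near_nonreal[OF z T(1)] by auto
      qed
      have dis: "U \<inter> path_image (closed_up \<gamma> \<delta> T) = {}"
        using closed_up(3)[OF \<gamma> \<delta> T(1)] U(3,4) nearU elim by blast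
      have "p \<in> outside (path_image (closed_up \<gamma> \<delta> T))"
      proof -
        have "U \<subseteq> connected_component_set (- path_image (closed_up \<gamma> \<delta> T)) p"
          using dis by (intro connected_component_maximal U) auto
        then have "\<not> bounded (connected_component_set (- path_image (closed_up \<gamma> \<delta> T)) p)"
          using U(5) bounded_subset by blast
        then show ?thesis using U(2) dis unfolding outside_def by blast
      qed
      then show ?case
        using closed_up[OF \<gamma> \<delta> T(1)] by (intro winding_number_zero_in_outside valid_path_imp_path)
    qed
    then show ?thesis
      using rl by (rule eventually_compose_filterlim)
  qed
  then have "\<forall>\<^sub>F n in sequentially. \<forall>p\<in>P. winding_number (closed_up \<gamma> \<delta> (real (Suc n))) p = 0"
    by (intro eventually_ball_finite P(1) ballI)
  then have "\<forall>\<^sub>F n in sequentially. contour_integral (closed_up \<gamma> \<delta> (real (Suc n))) f = 0"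
    using closed_up_limit(2)[OF \<gamma> \<delta> dec f P]
  proof eventually_elim
    case (elim n)
    have "(0::real) < real (Suc n)" by simp
    from closed_up(1,2)[OF \<gamma> \<delta> this] elim show ?case
      by (intro contour_integral_unique Cauchy_theorem_global[OF opP f]) auto
  qed
  then have "(\<lambda>n. contour_integral (closed_up \<gamma> \<delta> (real (Suc n))) f) \<longlonglongrightarrow> 0"
    by (rule tendsto_eventually)
  from LIMSEQ_unique[OF this closed_up_limit(1)[OF \<gamma> \<delta> dec f P]] show ?thesis by simp
qed

lemma infinite_integral_eq_entire:
  assumes "tail_curve \<gamma>" "tail_curve \<delta>" "decays f" "f holomorphic_on UNIV"
  shows "infinite_contour_integral \<gamma> f = infinite_contour_integral \<delta> f"
  using assms by (intro infinite_integral_eqI[where P = "{}"]) auto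

lemma reaches_notin_range: "reaches s \<gamma> p \<Longrightarrow> p \<notin> range \<gamma>"
  unfolding reaches_def by blast

text \<open>The vertex lies far out, opposite to the half-line that \<open>p\<close> reaches. The
  chevron is at distance more than \<open>R\<close> from 0, so it could meet \<open>U\<close> only
  on that half-line, but its only real point \<open>- s * X\<close> has the wrong sign.\<close>

lemma infinite_integral_eventually_chevron:
  assumes \<gamma>: "tail_curve \<gamma>" and s: "s = 1 \<or> s = -1" and p: "reaches s \<gamma> p"
    and f: "decays f" "f holomorphic_on -{p}"
  shows "\<forall>\<^sub>F X in at_top. infinite_contour_integral \<gamma> f = infinite_contour_integral (chevron (- s * X)) f"
proof -
  obtain U R where U: "connected U" "p \<in> U" "U \<inter> range \<gamma> = {}" "\<And>r. r \<ge> R \<Longrightarrow> of_real (s * r) \<in> U"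
    "\<And>z. z \<in> U \<Longrightarrow> norm z > R \<Longrightarrow> \<exists>r>0. z = of_real (s * r)"
    using p unfolding reaches_def by blast
  show ?thesis
    using eventually_gt_at_top[of "max 0 (2 * R)"]
  proof eventually_elim
    case (elim X)
    have X: "X > 0" "X > 2 * R" using elim by auto
    have dis: "chevron (- s * X) t \<notin> U" for t
    proof
      assume c: "chevron (- s * X) t \<in> U"
      have "\<bar>- s * X\<bar> = X" using s X by auto
      then have "norm (chevron (- s * X) t) > R" using chevron_norm[of "- s * X" t] X by linarith
      then obtain r where r: "r > 0" "chevron (- s * X) t = of_real (s * r)" using U(5)[OF c] by blast
      then have "t = 0" using chevron_real(1)[of "- s * X" t] by (metis Reals_of_real)
      then have "s * r = - s * X" using r(2) chevron_real(2)[of "- s * X"] by (metis of_real_eq_iff)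
      then show False using r(1) X s by auto
    qed
    have "\<not> bounded U"
    proof
      assume "bounded U"
      then obtain B where B: "\<And>z. z \<in> U \<Longrightarrow> norm z \<le> B" using bounded_iff by blast
      define r where "r = max R (\<bar>B\<bar> + 1)"
      have "norm (complex_of_real (s * r)) \<le> B" using B U(4) by (auto simp: r_def)
      moreover have "norm (complex_of_real (s * r)) = \<bar>r\<bar>" using s by (auto simp: norm_mult)
      ultimately show False by (auto simp: r_def)
    qed
    moreover have "\<forall>z\<in>U. norm z > R \<longrightarrow> z \<in> \<real>"
      using U(5) by (metis Reals_of_real)
    ultimately have "\<exists>U R. connected U \<and> p \<in> U \<and> U \<inter> range \<gamma> = {} \<and> U \<inter> range (chevron (- s * X)) = {} \<and>
      \<not> bounded U \<and> (\<forall>z\<in>U. norm z > R \<longrightarrow> z \<in> \<real>)"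
      using U(1-3) dis by (intro exI[of _ U] exI[of _ R]) auto
    moreover have "p \<notin> range (chevron (- s * X))" "p \<notin> range \<gamma>" using dis U(2,3) by auto
    ultimately show ?case
      by (intro infinite_integral_eqI[OF \<gamma> tail_curve_chevron f(1), where P = "{p}"]) (use f(2) in auto)
  qed
qed

text \<open>The sets witnessing \<open>reaches\<close> for \<open>\<gamma>\<close> and for
  \<open>\<delta>\<close> may each cross the other curve, which rules out a direct comparison. A
  sufficiently distant chevron avoids both sets and so agrees with both curves.\<close>

lemma infinite_integral_eq_reaches:
  assumes "tail_curve \<gamma>" "tail_curve \<delta>" "s = 1 \<or> s = -1" "reaches s \<gamma> p" "reaches s \<delta> p"
    and "decays f" "f holomorphic_on -{p}"
  shows "infinite_contour_integral \<gamma> f = infinite_contour_integral \<delta> f"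
proof -
  have "\<forall>\<^sub>F X::real in at_top. infinite_contour_integral \<gamma> f = infinite_contour_integral \<delta> f"
    using infinite_integral_eventually_chevron[OF assms(1,3,4,6,7)]
      infinite_integral_eventually_chevron[OF assms(2,3,5,6,7)]
    by eventually_elim simp
  then show ?thesis by simp
qed

section \<open>The residue between two chevrons\<close>

lemma real_notin_range_chevron:
  assumes "\<bar>p\<bar> < \<bar>r\<bar>"
  shows "of_real p \<notin> range (chevron r)"
proof
  assume "of_real p \<in> range (chevron r)"
  then obtain t where eq: "chevron r t = of_real p" by force
  then have "t = 0" using chevron_real(1)[of r t] by simp
  then have "r = p" using eq chevron_real(2)[of r] by simp
  then show False using assms by simp
qed

text \<open>The logarithms at the corners of the closed-up curve telescope to \<open>2\<pi>\<i>\<close>.\<close>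
lemma winding_number_chevrons:
  assumes "\<bar>p\<bar> < Y" "T > 0"
  shows "winding_number (closed_up (chevron Y) (chevron (-Y)) T) (of_real p) = 1"
proof -
  let ?q = "complex_of_real p"
  let ?f = "\<lambda>w. 1 / (w - ?q)"
  let ?a = "\<lambda>t. chevron Y t - ?q" and ?b = "\<lambda>t. chevron (-Y) t - ?q"
  have S: "?f holomorphic_on -{?q}" "open (-{?q})"
    by (auto intro!: holomorphic_intros)
  have imp: "Im (chevron r t) = sqrt 3 / 2 * t" for r t by (simp add: chevron_def)
  have seg: "Im w = sqrt 3 / 2 * t" if w: "w \<in> closed_segment (chevron Y t) (chevron (-Y) t)" for w t
  proof -
    obtain u where "w = (1 - u) *\<^sub>R chevron Y t + u *\<^sub>R chevron (-Y) t"
      using w unfolding closed_segment_def by blast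
    then have "Im w = (1 - u) * (sqrt 3 / 2 * t) + u * (sqrt 3 / 2 * t)" by (simp add: imp)
    also have "\<dots> = sqrt 3 / 2 * t" by (simp flip: distrib_right)
    finally show ?thesis .
  qed
  have im: "range (chevron Y) \<subseteq> -{?q}" "range (chevron (-Y)) \<subseteq> -{?q}"
    using assms(1) real_notin_range_chevron[of p Y] real_notin_range_chevron[of p "-Y"] by auto
  have im2: "closed_segment (chevron Y T) (chevron (-Y) T) \<subseteq> -{?q}"
      "closed_segment (chevron Y (-T)) (chevron (-Y) (-T)) \<subseteq> -{?q}"
    using seg assms(2) by fastforce+
  note vp = subpath_tail_curve[OF tail_curve_chevron assms(2)]
  have slit: "z \<notin> \<real>\<^sub>\<le>\<^sub>0" if "Im z \<noteq> 0 \<or> Re z > 0" for z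
    using that by (auto simp: complex_nonpos_Reals_iff)
  have prim1: "((\<lambda>w. Ln (w - ?q)) has_field_derivative ?f w) (at w within A)" if "w - ?q \<notin> \<real>\<^sub>\<le>\<^sub>0" for w A
    using that by (auto intro!: derivative_eq_intros simp: inverse_eq_divide)
  \<comment> \<open>The left chevron crosses the real axis to the left of \<open>p\<close>, on the
    cut of \<open>Ln (w - ?q)\<close>. The reflected logarithm has its cut to the right of
    \<open>p\<close>.\<close>
  have prim2: "((\<lambda>w. Ln (?q - w)) has_field_derivative ?f w) (at w within A)" if "?q - w \<notin> \<real>\<^sub>\<le>\<^sub>0" for w A
  proof -
    have "?q - w \<noteq> 0" using that by auto
    then have "- inverse (?q - w) = ?f w" by (simp add: inverse_eq_divide divide_simps)
    then show ?thesis using that by (auto intro!: derivative_eq_intros)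
  qed
  have 1: "contour_integral (subpath (-T) T (chevron Y)) ?f = Ln (?a T) - Ln (?a (-T))"
  proof -
    have "(?f has_contour_integral (Ln (pathfinish (subpath (-T) T (chevron Y)) - ?q) - Ln (pathstart (subpath (-T) T (chevron Y)) - ?q)))
        (subpath (-T) T (chevron Y))"
    proof (rule contour_integral_primitive[OF _ vp(1) order_refl])
      fix x assume "x \<in> path_image (subpath (-T) T (chevron Y))"
      then obtain t where t: "x = chevron Y t" using vp(2) by auto
      have "x - ?q \<notin> \<real>\<^sub>\<le>\<^sub>0"
        using assms(1) by (intro slit) (auto simp: t imp, simp add: chevron_def)
      then show "((\<lambda>w. Ln (w - ?q)) has_field_derivative ?f x) (at x within path_image (subpath (-T) T (chevron Y)))"
        by (rule prim1)
    qed
    then show ?thesis by (simp add: contour_integral_unique subpath_ends)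
  qed
  have 2: "contour_integral (subpath (-T) T (chevron (-Y))) ?f = Ln (- ?b T) - Ln (- ?b (-T))"
  proof -
    have "(?f has_contour_integral (Ln (?q - pathfinish (subpath (-T) T (chevron (-Y)))) - Ln (?q - pathstart (subpath (-T) T (chevron (-Y))))))
        (subpath (-T) T (chevron (-Y)))"
    proof (rule contour_integral_primitive[OF _ vp(1) order_refl])
      fix x assume "x \<in> path_image (subpath (-T) T (chevron (-Y)))"
      then obtain t where t: "x = chevron (-Y) t" using vp(2) by auto
      have "?q - x \<notin> \<real>\<^sub>\<le>\<^sub>0"
        using assms(1) by (intro slit) (auto simp: t imp, simp add: chevron_def)
      then show "((\<lambda>w. Ln (?q - w)) has_field_derivative ?f x) (at x within path_image (subpath (-T) T (chevron (-Y))))"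
        by (rule prim2)
    qed
    then show ?thesis by (simp add: contour_integral_unique subpath_ends)
  qed
  have lin: "contour_integral (linepath u v) ?f = Ln (v - ?q) - Ln (u - ?q)"
    if "\<And>w. w \<in> closed_segment u v \<Longrightarrow> Im w \<noteq> 0" for u v
  proof -
    have "(?f has_contour_integral (Ln (pathfinish (linepath u v) - ?q) - Ln (pathstart (linepath u v) - ?q))) (linepath u v)"
    proof (rule contour_integral_primitive[OF _ valid_path_linepath order_refl])
      fix x assume "x \<in> path_image (linepath u v)"
      then have "x - ?q \<notin> \<real>\<^sub>\<le>\<^sub>0" using that by (intro slit) auto
      then show "((\<lambda>w. Ln (w - ?q)) has_field_derivative ?f x) (at x within path_image (linepath u v))"
        by (rule prim1)
    qed
    then show ?thesis by (simp add: contour_integral_unique)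
  qed
  have 3: "contour_integral (linepath (chevron Y T) (chevron (-Y) T)) ?f = Ln (?b T) - Ln (?a T)"
    using seg[of _ T] assms(2) by (intro lin) force
  have 4: "contour_integral (linepath (chevron (-Y) (-T)) (chevron Y (-T))) ?f = Ln (?a (-T)) - Ln (?b (-T))"
    using seg[of _ "-T"] assms(2) by (intro lin) (auto simp: closed_segment_commute)
  have Imb: "Im (?b T) > 0" "Im (?b (-T)) < 0" using assms(2) by (simp_all add: imp)
  \<comment> \<open>Changing between the two logarithms costs \<open>- \<i> * pi\<close> above and
    \<open>+ \<i> * pi\<close> below the real axis; these two jumps make up the whole
    winding.\<close>
  have "Ln (- w) = Ln w - \<i> * pi" if "Im w > 0" for w
    using that Ln_minus[of w] by (cases "w = 0") auto
  moreover have "Ln (- w) = Ln w + \<i> * pi" if "Im w < 0" for w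
    using that Ln_minus[of w] by (cases "w = 0") auto
  ultimately have 5: "Ln (- ?b T) = Ln (?b T) - \<i> * pi" "Ln (- ?b (-T)) = Ln (?b (-T)) + \<i> * pi"
    using Imb by blast+
  have "contour_integral (closed_up (chevron Y) (chevron (-Y)) T) ?f = 2 * of_real pi * \<i>"
    by (subst contour_integral_closed_up[OF tail_curve_chevron tail_curve_chevron assms(2) S im im2])
      (simp only: 1 2 3 4 5, simp add: algebra_simps)
  moreover have "?q \<notin> path_image (closed_up (chevron Y) (chevron (-Y)) T)"
    using closed_up(3)[OF tail_curve_chevron tail_curve_chevron assms(2), of Y "-Y"] im im2 by blast
  ultimately show ?thesis
    using winding_number_valid_path[OF closed_up(1)[OF tail_curve_chevron tail_curve_chevron assms(2)]]
    by simp
qed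

text \<open>In the closed-up path the right chevron is run upwards and the left one downwards, so
  \<open>p\<close> is encircled counterclockwise.\<close>

lemma chevrons_residue:
  assumes Y: "\<bar>p\<bar> < Y" and f: "decays f" "f holomorphic_on -{of_real p}"
  shows "infinite_contour_integral (chevron Y) f - infinite_contour_integral (chevron (-Y)) f =
    2 * of_real pi * \<i> * residue f (of_real p)"
proof -
  let ?q = "complex_of_real p"
  have av: "range (chevron Y) \<inter> {?q} = {}" "range (chevron (-Y)) \<inter> {?q} = {}"
    using Y real_notin_range_chevron[of p Y] real_notin_range_chevron[of p "-Y"] by auto
  have fq: "finite {?q}" by simp
  have "\<forall>\<^sub>F n in sequentially. contour_integral (closed_up (chevron Y) (chevron (-Y)) (real (Suc n))) f =
      2 * of_real pi * \<i> * residue f ?q"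
    using closed_up_limit(2)[OF tail_curve_chevron tail_curve_chevron f fq av]
  proof eventually_elim
    case (elim n)
    have n: "(0::real) < real (Suc n)" by simp
    have "connected (UNIV :: complex set)" by (rule convex_connected[OF convex_UNIV])
    note res = Residue_theorem[OF open_UNIV this fq _ closed_up(1,2)[OF tail_curve_chevron tail_curve_chevron n]]
    have "contour_integral (closed_up (chevron Y) (chevron (-Y)) (real (Suc n))) f =
      2 * of_real pi * \<i> * (\<Sum>p\<in>{?q}. winding_number (closed_up (chevron Y) (chevron (-Y)) (real (Suc n))) p * residue f p)"
      using res[of f Y "-Y"] f(2) elim by (simp only: Compl_eq_Diff_UNIV) simp
    then show ?case using winding_number_chevrons[OF Y n] by simp
  qed
  then have "(\<lambda>n. contour_integral (closed_up (chevron Y) (chevron (-Y)) (real (Suc n))) f) \<longlonglongrightarrow>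
      2 * of_real pi * \<i> * residue f ?q"
    by (rule tendsto_eventually)
  from LIMSEQ_unique[OF closed_up_limit(1)[OF tail_curve_chevron tail_curve_chevron f fq av] this]
  show ?thesis by simp
qed

section \<open>Cubic exponentials with one pole\<close>

definition cubic_phase :: "real \<Rightarrow> complex \<Rightarrow> complex"
  where "cubic_phase \<xi> z = exp (- (z ^ 3) / 3 + \<xi> * z)"

text \<open>The one-variable factors of the expanded integrand: \<open>j\<close> is the order of the
  pole, and \<open>z ^ k\<close> comes from expanding a power of \<open>z + y\<close>. The case
  \<open>j = 0\<close> is the entire numerator.\<close>

definition phi :: "real \<Rightarrow> nat \<Rightarrow> nat \<Rightarrow> complex \<Rightarrow> complex \<Rightarrow> complex"
  where "phi \<xi> j k p z = cubic_phase \<xi> z * z ^ k / (z - p) ^ j"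

lemma cis_cube: "cis (2 * pi / 3) ^ 3 = 1" "cis (- 2 * pi / 3) ^ 3 = 1"
  by (simp_all add: Complex.DeMoivre) (simp_all add: cis.ctr complex_eq_iff)

text \<open>The directions are cube roots of unity, so \<open>z ^ 3\<close> is close to
  \<open>T ^ 3\<close>. The radius \<open>1/10\<close> is small enough because
  \<open>3/10 + 3/100 + 1/1000 \<le> 1/2\<close>.\<close>

lemma near_cube:
  assumes u: "u ^ 3 = 1" "norm u = 1" and z: "z \<in> near u (1/10) T" and T: "T > 0"
  shows "Re (z ^ 3) \<ge> T ^ 3 / 2"
proof -
  define d where "d = z / of_real T - u"
  have zd: "z = of_real T * (u + d)" using T by (simp add: d_def)
  have "norm (of_real T * d) \<le> 1/10 * T"
    using z by (simp add: near_def dist_norm zd algebra_simps norm_minus_commute)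
  then have d: "norm d \<le> 1/10" using T by (simp add: norm_mult field_simps)
  have d2: "norm d ^ 2 \<le> 1/10 * (1/10)" "norm d ^ 3 \<le> 1/10 * (1/10) * (1/10)"
    unfolding power2_eq_square power3_eq_cube using d by (intro mult_mono; simp)+
  have "norm ((u + d) ^ 3 - 1) = norm (3 * u ^ 2 * d + 3 * u * d ^ 2 + d ^ 3)"
    using u(1) by (simp add: power3_eq_cube power2_eq_square algebra_simps)
  also have "\<dots> \<le> norm (3 * u ^ 2 * d) + norm (3 * u * d ^ 2) + norm (d ^ 3)"
    by (intro order_trans[OF norm_triangle_ineq] add_right_mono norm_triangle_ineq)
  also have "\<dots> = 3 * norm d + 3 * norm d ^ 2 + norm d ^ 3"
    using u(2) by (simp add: norm_mult norm_power)
  also have "\<dots> \<le> 1/2" using d d2 by simp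
  finally have "\<bar>Re ((u + d) ^ 3 - 1)\<bar> \<le> 1/2" using abs_Re_le_cmod order_trans by blast
  then have "Re ((u + d) ^ 3) \<ge> 1/2" unfolding minus_complex.sel one_complex.sel by linarith
  moreover have "Re (z ^ 3) = T ^ 3 * Re ((u + d) ^ 3)"
    unfolding zd power_mult_distrib by (simp flip: of_real_power)
  ultimately show ?thesis using T mult_left_mono[of "1/2" "Re ((u + d) ^ 3)" "T ^ 3"] by simp
qed

lemma phi_decays: "decays (phi \<xi> j k p)"
proof -
  \<comment> \<open>With \<open>T \<ge> 1\<close>, the second bound lets \<open>T ^ 3 / 6\<close>
    absorb the linear exponents \<open>2 * \<bar>\<xi>\<bar> * T\<close> and
    \<open>2 * k * T\<close> and one further \<open>T\<close>. The third gives
    \<open>norm (z - p) \<ge> 1\<close>.\<close>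
  define T0 where "T0 = max 1 (max (6 * (1 + 2 * \<bar>\<xi>\<bar> + 2 * real k)) (2 * (norm p + 1)))"
  have "norm (phi \<xi> j k p z) \<le> 1 * exp (-T)" if T: "T \<ge> T0"
    and z: "z \<in> near (cis (2 * pi / 3)) (1/10) T \<union> near (cis (- 2 * pi / 3)) (1/10) T" for T z
  proof -
    have T': "T \<ge> 1" "T \<ge> 6 * (1 + 2 * \<bar>\<xi>\<bar> + 2 * real k)" "T \<ge> 2 * (norm p + 1)"
      using T by (auto simp: T0_def)
    have re: "Re (z ^ 3) \<ge> T ^ 3 / 2"
      using z near_cube[OF cis_cube(1)] near_cube[OF cis_cube(2)] T'(1) by auto
    have "(1 - 1/10) * T \<le> norm z \<and> norm z \<le> (1 + 1/10) * T"
      using z near_norm T'(1) by (metis Un_iff order_trans zero_le_one)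
    then have nz: "norm z \<ge> 9/10 * T" "norm z \<le> 11/10 * T" by simp_all
    have "norm (z - p) \<ge> 1"
      using norm_triangle_ineq2[of z p] nz(1) T'(1,3) norm_ge_zero[of p] by argo
    then have den: "norm ((z - p) ^ j) \<ge> 1" by (simp add: norm_power one_le_power)
    have "\<xi> * Re z \<le> \<bar>\<xi>\<bar> * (2 * T)"
    proof -
      have "\<xi> * Re z \<le> \<bar>\<xi>\<bar> * \<bar>Re z\<bar>" by (metis abs_ge_self abs_mult)
      also have "\<dots> \<le> \<bar>\<xi>\<bar> * (2 * T)"
      proof (intro mult_left_mono)
        have "norm z \<le> 2 * T" using nz(2) T'(1) by linarith
        then show "\<bar>Re z\<bar> \<le> 2 * T" by (rule order_trans[OF abs_Re_le_cmod])
      qed simp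
      finally show ?thesis .
    qed
    then have "norm (cubic_phase \<xi> z) \<le> exp (- (T ^ 3 / 6) + \<bar>\<xi>\<bar> * (2 * T))"
      using re by (simp add: cubic_phase_def)
    moreover have "norm (z ^ k) \<le> exp (real k * (2 * T))"
    proof -
      have "norm z \<le> exp (2 * T)" using nz exp_ge_add_one_self[of "2 * T"] T'(1) by linarith
      then show ?thesis by (simp add: norm_power exp_of_nat_mult power_mono)
    qed
    ultimately have "norm (cubic_phase \<xi> z * z ^ k) \<le> exp (- (T ^ 3 / 6) + \<bar>\<xi>\<bar> * (2 * T)) * exp (real k * (2 * T))"
      unfolding norm_mult by (intro mult_mono) auto
    also have "\<dots> = exp (- (T ^ 3 / 6) + \<bar>\<xi>\<bar> * (2 * T) + real k * (2 * T))" by (simp flip: exp_add)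
    also have "\<dots> \<le> exp (-T)"
    proof -
      have "6 * (1 + 2 * \<bar>\<xi>\<bar> + 2 * real k) * T \<le> (T * T) * T"
        using T' mult_mono[of 1 T "6 * (1 + 2 * \<bar>\<xi>\<bar> + 2 * real k)" T] by (intro mult_right_mono) auto
      then show ?thesis by (simp add: power3_eq_cube algebra_simps)
    qed
    finally have num: "norm (cubic_phase \<xi> z * z ^ k) \<le> exp (-T)" .
    have "norm (phi \<xi> j k p z) \<le> exp (-T) / 1"
      unfolding phi_def norm_divide using num den by (intro frac_le) auto
    then show ?thesis by simp
  qed
  then show ?thesis
    unfolding decays_def eventually_at_top_linorder
    by (intro exI[of _ "1/10"] exI[of _ 1] conjI exI[of _ T0]) auto
qed

lemma phi_holomorphic: "phi \<xi> j k p holomorphic_on -{p}"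
  unfolding phi_def[abs_def] cubic_phase_def by (intro holomorphic_intros) auto

text \<open>
  The vertex depends on \<open>p\<close>: the chevron has \<open>p\<close> on its right for \<open>s = 1\<close> and on its left for
  \<open>s = -1\<close>, the same sign convention as for \<open>reaches\<close>.
\<close>
definition phi_integral :: "real \<Rightarrow> real \<Rightarrow> nat \<Rightarrow> nat \<Rightarrow> complex \<Rightarrow> complex"
  where "phi_integral s \<xi> j k p = infinite_contour_integral (chevron (- s * (2 * norm p + 1))) (phi \<xi> j k p)"

lemma infinite_integral_phi:
  assumes "tail_curve \<gamma>" "s = 1 \<or> s = -1" "reaches s \<gamma> p"
  shows "infinite_contour_integral \<gamma> (phi \<xi> j k p) = phi_integral s \<xi> j k p"
  unfolding phi_integral_def
  using assms reaches_chevron[OF assms(2), of p "2 * norm p + 1"]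
  by (intro infinite_integral_eq_reaches[OF _ tail_curve_chevron _ _ _ phi_decays phi_holomorphic]) auto

lemma phi_integral_residue:
  "phi_integral (-1) \<xi> j k (of_real p) - phi_integral 1 \<xi> j k (of_real p) =
    2 * of_real pi * \<i> * residue (phi \<xi> j k (of_real p)) (of_real p)"
  using chevrons_residue[OF _ phi_decays phi_holomorphic, of p "2 * \<bar>p\<bar> + 1"]
  by (simp add: phi_integral_def)

section \<open>Dependence of the one-pole integrals on the pole\<close>

lemma valid_path_derivative_bounded:
  assumes "valid_path g" "L-lipschitz_on UNIV g"
  obtains B where "\<And>t. t \<in> {0..1} \<Longrightarrow> norm (vector_derivative g (at t)) \<le> B"
proof -
  obtain S where S: "finite S" "\<And>t. t \<in> {0..1} - S \<Longrightarrow> g differentiable (at t)"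
    using assms(1) unfolding valid_path_def piecewise_C1_differentiable_on_def C1_differentiable_on_eq by blast
  show ?thesis
  proof (rule that)
    fix t :: real assume "t \<in> {0..1}"
    \<comment> \<open>At the finitely many corners the derivative is an unspecified value, which the
      added sum covers: \<open>Cauchy_next_derivative\<close> will be given a bound at every
      parameter.\<close>
    show "norm (vector_derivative g (at t)) \<le> L + (\<Sum>t\<in>S. norm (vector_derivative g (at t)))"
    proof (cases "t \<in> S")
      case True
      then have "norm (vector_derivative g (at t)) \<le> (\<Sum>t\<in>S. norm (vector_derivative g (at t)))"
        using S(1) by (intro member_le_sum) auto
      then show ?thesis using lipschitz_on_nonneg[OF assms(2)] by simp
    next
      case False
      then have "norm (vector_derivative g (at t)) \<le> L"
        using S(2) \<open>t \<in> {0..1}\<close> by (intro lipschitz_vector_derivative_bound[OF assms(2)]) auto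
      then show ?thesis using sum_nonneg[of S "\<lambda>t. norm (vector_derivative g (at t))"] by simp
    qed
  qed
qed

text \<open>The defining chevron moves with \<open>p\<close>, so on \<open>ball 0 R\<close> it is
  replaced by a fixed one that clears the ball by \<open>1/2\<close>. The truncated integrals are
  Cauchy-type integrals, holomorphic in the pole, and their error is uniform on the ball.\<close>

lemma phi_integral_holomorphic:
  assumes s: "s = 1 \<or> s = -1" and j: "j \<noteq> 0"
  shows "phi_integral s \<xi> j k holomorphic_on UNIV"
proof -
  have ball: "phi_integral s \<xi> j k holomorphic_on ball 0 R" if R: "R > 0" for R
  proof -
    define \<gamma> where "\<gamma> = chevron (- s * (2 * R + 1))"
    have \<gamma>: "tail_curve \<gamma>" unfolding \<gamma>_def by (rule tail_curve_chevron)
    obtain B where B: "B-lipschitz_on UNIV \<gamma>" using \<gamma> unfolding tail_curve_def by blast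
    let ?h = "phi \<xi> 0 k 0"
    have h: "?h holomorphic_on UNIV"
      unfolding phi_def[abs_def] cubic_phase_def by (intro holomorphic_intros) auto
    obtain C where C: "\<And>t. norm (?h (\<gamma> t)) \<le> C * exp (- \<bar>t\<bar>)"
      using decays_along[OF \<gamma> phi_decays[of \<xi> 0 k 0]] h holomorphic_on_imp_continuous_on continuous_on_subset
      by (metis subset_UNIV)
    have C0: "C \<ge> 0" using order_trans[OF norm_ge_zero C[of 0]] by simp
    have eq: "phi_integral s \<xi> j k p = infinite_contour_integral \<gamma> (phi \<xi> j k p)" if "p \<in> ball 0 R" for p
      unfolding \<gamma>_def using that
      by (intro infinite_integral_phi[OF tail_curve_chevron s reaches_chevron[OF s], symmetric]) auto
    have dist: "norm (\<gamma> t - p) \<ge> 1/2" if "p \<in> ball 0 R" for p t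
    proof -
      have "\<bar>- s * (2 * R + 1)\<bar> = 2 * R + 1" using s R by auto
      then have "norm (\<gamma> t) \<ge> R + 1/2"
        using chevron_norm[of "- s * (2 * R + 1)" t] unfolding \<gamma>_def by simp
      then show ?thesis using norm_triangle_ineq2[of "\<gamma> t" p] that by simp
    qed
    have av: "range \<gamma> \<subseteq> -{p}" if p: "p \<in> ball 0 R" for p
    proof -
      have "\<gamma> t \<noteq> p" for t using dist[OF p, of t] by auto
      then show ?thesis by auto
    qed
    have bound: "norm (phi \<xi> j k p (\<gamma> t)) \<le> (2 ^ j * C) * exp (- \<bar>t\<bar>)" if p: "p \<in> ball 0 R" for p t
    proof -
      have "(1/2) ^ j \<le> norm ((\<gamma> t - p) ^ j)"
        using dist[OF p] by (simp add: norm_power power_mono)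
      then have "norm (phi \<xi> j k p (\<gamma> t)) \<le> (C * exp (- \<bar>t\<bar>)) / (1/2) ^ j"
        using C[of t] C0 unfolding phi_def norm_divide by (intro frac_le) auto
      then show ?thesis by (simp add: field_simps)
    qed
    define g where "g n p = contour_integral (subpath (- real (Suc n)) (real (Suc n)) \<gamma>) (phi \<xi> j k p)" for n p
    have hol: "g n holomorphic_on ball 0 R" for n
    proof -
      define N where "N = real (Suc n)"
      have N: "N > 0" by (simp add: N_def)
      define c where "c = subpath (-N) N \<gamma>"
      have c: "valid_path c" "path_image c = \<gamma> ` {-N..N}"
        unfolding c_def using subpath_tail_curve[OF \<gamma> N] by auto
      have "(B * (2 * N))-lipschitz_on UNIV c"
      proof (rule lipschitz_onI)
        fix x y
        have "dist (c x) (c y) \<le> B * dist ((2 * N) * x - N) ((2 * N) * y - N)"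
          unfolding c_def subpath_def using lipschitz_onD[OF B, of "(2 * N) * x - N" "(2 * N) * y - N"] by simp
        also have "\<dots> = B * (2 * N) * dist x y"
          using N by (simp add: dist_real_def abs_mult flip: right_diff_distrib)
        finally show "dist (c x) (c y) \<le> B * (2 * N) * dist x y" .
      qed (use N lipschitz_on_nonneg[OF B] in auto)
      from valid_path_derivative_bounded[OF c(1) this] obtain D where
        D: "\<And>t. t \<in> {0..1} \<Longrightarrow> norm (vector_derivative c (at t)) \<le> D" by blast
      have "(g n has_field_derivative
          (of_nat j * contour_integral c (\<lambda>u. ?h u / (u - w) ^ Suc j))) (at w)" if w: "w \<in> ball 0 R" for w
      proof (rule Cauchy_next_derivative(2)[where S = "ball 0 R", OF _ D _ j open_ball c(1)])
        show "continuous_on (path_image c) ?h"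
          using h holomorphic_on_imp_continuous_on continuous_on_subset by blast
        show "w \<in> ball 0 R - path_image c" using w av c(2) by fastforce
        fix v assume v: "v \<in> ball 0 R - path_image c"
        then have "phi \<xi> j k v contour_integrable_on c"
          using av[of v] c by (intro contour_integrable_holomorphic_simple[OF phi_holomorphic]) auto
        then have "(phi \<xi> j k v has_contour_integral g n v) c"
          unfolding g_def c_def N_def by (rule has_contour_integral_integral)
        then show "((\<lambda>u. ?h u / (u - v) ^ j) has_contour_integral g n v) c"
          by (simp add: phi_def[abs_def])
      qed
      then show ?thesis
        by (intro holomorphic_onI) (meson field_differentiable_at_within field_differentiable_def)
    qed
    have ul: "uniform_limit (ball 0 R) g (phi_integral s \<xi> j k) sequentially"
    proof (rule uniform_limitI)
      fix e :: real assume "e > 0"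
      have "(\<lambda>n. 2 ^ j * C * B * exp_tail n) \<longlonglongrightarrow> 2 ^ j * C * B * 0"
        by (intro tendsto_intros exp_tail_tendsto)
      then have "\<forall>\<^sub>F n in sequentially. 2 ^ j * C * B * exp_tail n < e"
        using \<open>e > 0\<close> by (intro order_tendstoD) auto
      then show "\<forall>\<^sub>F n in sequentially. \<forall>x\<in>ball 0 R. dist (g n x) (phi_integral s \<xi> j k x) < e"
      proof eventually_elim
        case (elim n)
        have "dist (g n p) (phi_integral s \<xi> j k p) \<le> 2 ^ j * C * B * exp_tail n" if p: "p \<in> ball 0 R" for p
          unfolding dist_norm eq[OF p] g_def
          by (rule infinite_integral_limit(4)[OF \<gamma> phi_decays phi_holomorphic _ av[OF p] B bound[OF p]]) auto
        then show ?case using elim by fastforce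
      qed
    qed
    show ?thesis
    proof (rule holomorphic_uniform_sequence[OF open_ball hol])
      fix x :: complex assume "x \<in> ball 0 R"
      then obtain d where d: "d > 0" "cball x d \<subseteq> ball 0 R"
        by (metis open_ball open_contains_cball)
      then show "\<exists>d>0. cball x d \<subseteq> ball 0 R \<and> uniform_limit (cball x d) g (phi_integral s \<xi> j k) sequentially"
        using uniform_limit_on_subset[OF ul d(2)] by (intro exI[of _ d]) simp
    qed
  qed
  show ?thesis
  proof (rule holomorphic_onI)
    fix p :: complex
    have "norm p + 1 > 0" by (simp add: add_nonneg_pos)
    from holomorphic_on_imp_differentiable_at[OF ball[OF this] open_ball]
    show "phi_integral s \<xi> j k field_differentiable at p within UNIV" by simp
  qed
qed

text \<open>The chevron with vertex \<open>-1\<close> lies in the half-plane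
  \<open>Re z \<le> -1\<close>, so one fixed curve keeps distance at least 1 from every such pole.
  Evaluated at \<open>- z\<close>, the bound covers the left half-plane, where the tails of the
  outer contour lie.\<close>

lemma phi_integral_bounded:
  obtains K where "\<And>p. Re p \<ge> 0 \<Longrightarrow> norm (phi_integral 1 \<xi> 1 k p) \<le> K"
proof -
  let ?\<gamma> = "chevron (-1)"
  let ?h = "phi \<xi> 0 k 0"
  obtain B where B: "B-lipschitz_on UNIV ?\<gamma>" using tail_curve_chevron unfolding tail_curve_def by blast
  have h: "?h holomorphic_on UNIV"
    unfolding phi_def[abs_def] cubic_phase_def by (intro holomorphic_intros) auto
  obtain C where C: "\<And>t. norm (?h (?\<gamma> t)) \<le> C * exp (- \<bar>t\<bar>)"
    using decays_along[OF tail_curve_chevron phi_decays[of \<xi> 0 k 0]] h holomorphic_on_imp_continuous_on continuous_on_subset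
    by (metis subset_UNIV)
  have C0: "C \<ge> 0" using order_trans[OF norm_ge_zero C[of 0]] by simp
  have Re: "Re (?\<gamma> t) \<le> -1" for t by (simp add: chevron_def)
  show ?thesis
  proof (rule that)
    fix p :: complex assume p: "Re p \<ge> 0"
    have seg: "Re z \<ge> 0" if "z \<in> closed_segment 0 p" for z
      using that p by (auto simp: closed_segment_def)
    have "reaches 1 ?\<gamma> p"
    proof (rule reaches_segment)
      have "?\<gamma> t \<notin> closed_segment 0 p" for t
        using seg[of "?\<gamma> t"] Re[of t] by fastforce
      then show "closed_segment 0 p \<inter> range ?\<gamma> = {}" by blast
      show "complex_of_real (1 * x) \<notin> range ?\<gamma>" if "x \<ge> 0" for x
      proof
        assume "complex_of_real (1 * x) \<in> range ?\<gamma>"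
        then obtain t where "complex_of_real (1 * x) = ?\<gamma> t" by blast
        then have "x = Re (?\<gamma> t)" by (metis Re_complex_of_real mult_1)
        then show False using Re[of t] that by simp
      qed
    qed simp
    then have eq: "phi_integral 1 \<xi> 1 k p = infinite_contour_integral ?\<gamma> (phi \<xi> 1 k p)"
      by (intro infinite_integral_phi[symmetric] tail_curve_chevron) auto
    have dist: "norm (?\<gamma> t - p) \<ge> 1" for t
      using Re[of t] p abs_Re_le_cmod[of "?\<gamma> t - p"] by simp
    have bound: "norm (phi \<xi> 1 k p (?\<gamma> t)) \<le> C * exp (- \<bar>t\<bar>)" for t
    proof -
      have "norm (phi \<xi> 1 k p (?\<gamma> t)) \<le> (C * exp (- \<bar>t\<bar>)) / 1"
        unfolding phi_def norm_divide using C[of t] C0 dist[of t] by (intro frac_le) (auto simp: phi_def)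
      then show ?thesis by simp
    qed
    have av: "range ?\<gamma> \<subseteq> -{p}"
    proof -
      have "?\<gamma> t \<noteq> p" for t using dist[of t] by auto
      then show ?thesis by auto
    qed
    have op: "open (-{p})" by auto
    show "norm (phi_integral 1 \<xi> 1 k p) \<le> C * B * integral UNIV (\<lambda>t. exp (- \<bar>t\<bar>))"
      unfolding eq by (rule infinite_integral_limit(3)[OF tail_curve_chevron phi_decays phi_holomorphic op av B bound])
  qed
qed

text \<open>\<open>infinite_contour_integral\<close> is total and does not record convergence, so it
  is not additive by itself. The relational form carries integrability along.\<close>

definition has_infinite_integral :: "(real \<Rightarrow> complex) \<Rightarrow> (complex \<Rightarrow> complex) \<Rightarrow> complex \<Rightarrow> bool"
  where "has_infinite_integral \<gamma> f I \<longleftrightarrow>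
    ((\<lambda>t. f (\<gamma> t) * vector_derivative \<gamma> (at t)) has_integral I) UNIV"

lemma has_infinite_integral_unique:
  "has_infinite_integral \<gamma> f I \<Longrightarrow> infinite_contour_integral \<gamma> f = I"
  unfolding has_infinite_integral_def infinite_contour_integral_def by (rule integral_unique)

lemma has_infinite_integral_add:
  "has_infinite_integral \<gamma> f I \<Longrightarrow> has_infinite_integral \<gamma> g J \<Longrightarrow>
    has_infinite_integral \<gamma> (\<lambda>z. f z + g z) (I + J)"
  unfolding has_infinite_integral_def by (simp add: distrib_right has_integral_add)

lemma has_infinite_integral_lmul:
  "has_infinite_integral \<gamma> f I \<Longrightarrow> has_infinite_integral \<gamma> (\<lambda>z. c * f z) (c * I)"
  unfolding has_infinite_integral_def by (simp add: mult.assoc has_integral_mult_right)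

lemma has_infinite_integral_sum:
  "finite A \<Longrightarrow> (\<And>i. i \<in> A \<Longrightarrow> has_infinite_integral \<gamma> (f i) (I i)) \<Longrightarrow>
    has_infinite_integral \<gamma> (\<lambda>z. \<Sum>i\<in>A. f i z) (\<Sum>i\<in>A. I i)"
  unfolding has_infinite_integral_def by (simp add: sum_distrib_right has_integral_sum)

lemma has_infinite_integral_spike:
  assumes "has_infinite_integral \<gamma> f I" "finite N" "\<And>t. t \<notin> N \<Longrightarrow> f (\<gamma> t) = g (\<gamma> t)"
  shows "has_infinite_integral \<gamma> g I"
  using assms(1) unfolding has_infinite_integral_def
  by (rule has_integral_spike_finite[OF assms(2), rotated]) (simp add: assms(3))

lemma has_infinite_integral_phi:
  assumes "tail_curve \<gamma>" "s = 1 \<or> s = -1" "reaches s \<gamma> p"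
  shows "has_infinite_integral \<gamma> (phi \<xi> j k p) (phi_integral s \<xi> j k p)"
proof -
  obtain B where B: "B-lipschitz_on UNIV \<gamma>" using assms(1) unfolding tail_curve_def by blast
  have "range \<gamma> \<subseteq> -{p}" "open (-{p})" using reaches_notin_range[OF assms(3)] by auto
  then have "(\<lambda>t. phi \<xi> j k p (\<gamma> t) * vector_derivative \<gamma> (at t)) integrable_on UNIV"
    using infinite_integral_limit(1)[OF assms(1) phi_decays phi_holomorphic _ _ B] by blast
  then show ?thesis
    using infinite_integral_phi[OF assms, symmetric]
    unfolding has_infinite_integral_def infinite_contour_integral_def by (simp only: integrable_integral)
qed

section \<open>Reflection of the contours of the second variable\<close>

lemma infinite_integral_reflect:
  assumes "tail_curve (\<lambda>t. - \<gamma> t)"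
  shows "infinite_contour_integral \<gamma> g = - infinite_contour_integral (\<lambda>t. - \<gamma> t) (\<lambda>z. g (- z))"
proof -
  have "vector_derivative \<gamma> (at t) = - vector_derivative (\<lambda>t. - \<gamma> t) (at t)"
    if "(\<lambda>t. - \<gamma> t) differentiable (at t)" for t
    using has_vector_derivative_minus[OF that[unfolded vector_derivative_works]] by (simp add: vector_derivative_at)
  then have "integral UNIV (\<lambda>t. g (\<gamma> t) * vector_derivative \<gamma> (at t)) =
      integral UNIV (\<lambda>t. - (g (\<gamma> t) * vector_derivative (\<lambda>t. - \<gamma> t) (at t)))"
    by (intro integral_spike[OF tail_curve_negligible[OF assms]]) auto
  then show ?thesis by (simp add: infinite_contour_integral_def)
qed

text \<open>Negation sends \<open>cis (pi / 3)\<close> to \<open>cis (- 2 * pi / 3)\<close> and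
  \<open>cis (- pi / 3)\<close> to \<open>cis (2 * pi / 3)\<close>, so the directions at both ends
  fit without reversing the parameter.\<close>

lemma infinite_curve_reflect:
  assumes "infinite_curve (cis (pi / 3)) (cis (- pi / 3)) \<gamma>"
  shows "tail_curve (\<lambda>t. - \<gamma> t)"
proof -
  have cis: "cis (2 * pi / 3) = - cis (- pi / 3)" "cis (- 2 * pi / 3) = - cis (pi / 3)"
    unfolding cis_120 using cos_60 sin_60 by (auto simp: complex_eq_iff)
  obtain B where "B-lipschitz_on UNIV \<gamma>" using assms unfolding infinite_curve_def by blast
  then have "B-lipschitz_on UNIV (\<lambda>t. - \<gamma> t)" by (simp add: lipschitz_on_minus)
  moreover have "(\<lambda>t. - \<gamma> t) piecewise_C1_differentiable_on {-T..T}" if "T > 0" for T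
    using assms that unfolding infinite_curve_def by (simp add: piecewise_C1_differentiable_neg)
  ultimately show ?thesis
    using assms unfolding tail_curve_def infinite_curve_def cis
    by (auto intro: tendsto_minus)
qed

lemma connected_component_reflect:
  fixes \<gamma> :: "real \<Rightarrow> complex"
  assumes "connected_component (- range \<gamma>) p q"
  shows "connected_component (- range (\<lambda>t. - \<gamma> t)) (- p) (- q)"
proof -
  obtain T where T: "connected T" "T \<subseteq> - range \<gamma>" "p \<in> T" "q \<in> T"
    using assms unfolding connected_component_def by blast
  have "connected (uminus ` T)" by (intro connected_continuous_image T continuous_intros)
  moreover have "uminus ` T \<subseteq> - range (\<lambda>t. - \<gamma> t)" using T(2) by auto
  ultimately show ?thesis using T(3,4) unfolding connected_component_def by blast
qed

text \<open>Negation interchanges the two real half-lines, so the left of \<open>\<gamma>\<close>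
  becomes side \<open>1\<close> of the reflected curve.\<close>

lemma left_of_imp_reaches_reflect:
  assumes "tail_curve (\<lambda>t. - \<gamma> t)" "p \<in> left_of \<gamma>"
  shows "reaches 1 (\<lambda>t. - \<gamma> t) (- p)"
proof -
  obtain N where N: "\<And>x. x \<le> N \<Longrightarrow> connected_component (- range \<gamma>) p (of_real x)"
    using assms(2) unfolding left_of_def eventually_at_bot_linorder by blast
  show ?thesis
    using connected_component_reflect[OF N, of "- _"] by (intro reachesI[OF assms(1), of _ "-N"]) auto
qed

lemma right_of_imp_reaches_reflect:
  assumes "tail_curve (\<lambda>t. - \<gamma> t)" "p \<in> right_of \<gamma>"
  shows "reaches (-1) (\<lambda>t. - \<gamma> t) (- p)"
proof -
  obtain N where N: "\<And>x. x \<ge> N \<Longrightarrow> connected_component (- range \<gamma>) p (of_real x)"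
    using assms(2) unfolding right_of_def eventually_at_top_linorder by blast
  show ?thesis
    using connected_component_reflect[OF N] by (intro reachesI[OF assms(1), of _ N]) auto
qed

text \<open>Both directions have real part \<open>-1/2\<close>, so discs of relative radius at most
  \<open>1/2\<close> lie in the left half-plane, where \<open>g\<close> is bounded.\<close>

lemma decays_mult_bounded:
  assumes "decays f" "\<And>z. Re z \<le> 0 \<Longrightarrow> norm (g z) \<le> K"
  shows "decays (\<lambda>z. f z * g z)"
proof -
  obtain \<epsilon> C T1 where \<epsilon>: "\<epsilon> > 0" and C: "\<And>T z. T \<ge> T1 \<Longrightarrow> z \<in> near (cis (2 * pi / 3)) \<epsilon> T \<union>
      near (cis (- 2 * pi / 3)) \<epsilon> T \<Longrightarrow> norm (f z) \<le> C * exp (- T)"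
    using assms(1) unfolding decays_def eventually_at_top_linorder by blast
  define \<eta> where "\<eta> = min \<epsilon> (1/2)"
  have \<eta>: "\<eta> > 0" "\<eta> \<le> \<epsilon>" "\<eta> \<le> 1/2" using \<epsilon> by (auto simp: \<eta>_def)
  have "norm (f z * g z) \<le> (C * K) * exp (-T)" if T: "T \<ge> max T1 1"
    and z: "z \<in> near (cis (2 * pi / 3)) \<eta> T \<union> near (cis (- 2 * pi / 3)) \<eta> T" for T z
  proof -
    have T': "T \<ge> T1" "T \<ge> 0" using T by auto
    have f: "norm (f z) \<le> C * exp (- T)"
      using z near_mono[OF \<eta>(2) T'(2)] by (intro C T') auto
    have "(\<eta> - 1/2) * T \<le> 0" using \<eta>(3) T'(2) by (simp add: mult_nonpos_nonneg)
    with near_Re[OF z] have "Re z \<le> 0" by simp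
    then have "norm (g z) \<le> K" by (rule assms(2))
    then have "norm (f z) * norm (g z) \<le> (C * exp (-T)) * K"
      using f by (intro mult_mono) (auto intro: order_trans[OF norm_ge_zero])
    then show ?thesis by (simp add: norm_mult algebra_simps)
  qed
  then show ?thesis
    unfolding decays_def eventually_at_top_linorder using \<eta>(1) by blast
qed

text \<open>
  For \<open>z\<close> to the left of the inner curve, \<open>- phi_integral 1 \<xi>1 1 0 (- z)\<close> is the inner integral of
  the Airy term.
\<close>
definition airy_part :: "real \<Rightarrow> real \<Rightarrow> complex"
  where "airy_part \<xi>1 \<xi>2 =
    infinite_contour_integral (chevron 0) (\<lambda>z. cubic_phase \<xi>2 z * phi_integral 1 \<xi>1 1 0 (- z))"

lemma cubic_phase_holomorphic: "cubic_phase \<xi> holomorphic_on S"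
  unfolding cubic_phase_def[abs_def] by (intro holomorphic_intros) auto

lemma cubic_phase_phi_integral_holomorphic:
  assumes "s = 1 \<or> s = -1"
  shows "(\<lambda>z. cubic_phase \<xi>2 z * phi_integral s \<xi>1 1 0 (- z)) holomorphic_on S"
proof -
  have "(phi_integral s \<xi>1 1 0 \<circ> uminus) holomorphic_on S"
    by (intro holomorphic_on_compose holomorphic_intros
      holomorphic_on_subset[OF phi_integral_holomorphic[OF assms]]) auto
  then show ?thesis
    by (intro holomorphic_on_mult cubic_phase_holomorphic) (simp add: o_def)
qed

text \<open>The function is entire, because the side of the inner pole is frozen at
  \<open>1\<close>, and it decays by \<open>phi_integral_bounded\<close>. Hence every tail curve
  gives the same value, wherever it runs relative to \<open>a\<close> and \<open>b\<close>.\<close>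

lemma has_infinite_integral_airy_part:
  assumes "tail_curve \<gamma>"
  shows "has_infinite_integral \<gamma> (\<lambda>z. cubic_phase \<xi>2 z * phi_integral 1 \<xi>1 1 0 (- z)) (airy_part \<xi>1 \<xi>2)"
proof -
  let ?f = "\<lambda>z. cubic_phase \<xi>2 z * phi_integral 1 \<xi>1 1 0 (- z)"
  obtain K where K: "\<And>p. Re p \<ge> 0 \<Longrightarrow> norm (phi_integral 1 \<xi>1 1 0 p) \<le> K"
    using phi_integral_bounded by blast
  have "decays (cubic_phase \<xi>2)"
    using phi_decays[of \<xi>2 0 0 0] by (simp add: phi_def[abs_def])
  then have dec: "decays ?f" using K by (rule decays_mult_bounded) auto
  have hol: "?f holomorphic_on UNIV" by (rule cubic_phase_phi_integral_holomorphic) simp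
  obtain B where B: "B-lipschitz_on UNIV \<gamma>" using assms unfolding tail_curve_def by blast
  have "(\<lambda>t. ?f (\<gamma> t) * vector_derivative \<gamma> (at t)) integrable_on UNIV"
    using infinite_integral_limit(1)[OF assms dec hol open_UNIV subset_UNIV B] .
  then have "has_infinite_integral \<gamma> ?f (infinite_contour_integral \<gamma> ?f)"
    unfolding has_infinite_integral_def infinite_contour_integral_def by (rule integrable_integral)
  then show ?thesis
    by (simp only: airy_part_def infinite_integral_eq_entire[OF assms tail_curve_chevron[of 0] dec hol])
qed

section \<open>Expansion of the integrand\<close>

text \<open>Index \<open>j\<close> stands for the binomial term of order \<open>Suc j\<close>; order
  0 is the Airy term. The difference is \<open>a - b\<close> rather than \<open>b - a\<close>
  because \<open>w - b = - (y + b)\<close> for \<open>w = - y\<close>.\<close>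

definition coeff :: "nat \<Rightarrow> complex \<Rightarrow> complex \<Rightarrow> nat \<Rightarrow> nat \<Rightarrow> complex"
  where "coeff m a b j k = of_nat (m choose Suc j) * of_nat (j choose k) * (a - b) ^ Suc j"

text \<open>Bilinear in the tables \<open>P\<close> and \<open>Q\<close>: integrating in one
  variable replaces one table by the table of its integrals.\<close>

definition expansion ::
  "nat \<Rightarrow> complex \<Rightarrow> complex \<Rightarrow> (nat \<Rightarrow> nat \<Rightarrow> complex) \<Rightarrow> (nat \<Rightarrow> nat \<Rightarrow> complex) \<Rightarrow> complex"
  where "expansion m a b P Q = (\<Sum>j<m. \<Sum>k\<le>j. coeff m a b j k * P j k * Q j k)"

lemma integrand_expand:
  assumes "z \<noteq> of_real a" "y \<noteq> - of_real b" "y \<noteq> - z"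
  shows "integrand m \<xi>1 \<xi>2 a b z (- y) =
    cubic_phase \<xi>2 z * phi \<xi>1 1 0 (- z) y +
    expansion m a b (\<lambda>j k. phi \<xi>2 (Suc j) k a z) (\<lambda>j k. phi \<xi>1 (Suc j) (j - k) (- of_real b) y)"
proof -
  let ?a = "complex_of_real a" and ?b = "complex_of_real b"
  have "z + y \<noteq> 0" using assms(3) by (metis add.inverse_unique)
  moreover have "y + ?b \<noteq> 0" using assms(2) by (metis add.inverse_unique add.commute)
  ultimately have nz: "z - ?a \<noteq> 0" "y + ?b \<noteq> 0" "z + y \<noteq> 0" using assms(1) by simp_all
  define r where "r = (?a - ?b) / ((z - ?a) * (y + ?b))"
  define q where "q = (z + y) * r"
  have nb: "- y - ?b = - (y + ?b)" "- y - ?a = - (y + ?a)" by simp_all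
  have frac: "(- E) / B * (C / (- D)) = E * C / (B * D)" for B C D E :: complex by simp
  have q: "(- y - ?a) / (z - ?a) * ((z - ?b) / (- y - ?b)) = 1 + q"
  proof -
    have "(- y - ?a) / (z - ?a) * ((z - ?b) / (- y - ?b)) = (y + ?a) * (z - ?b) / ((z - ?a) * (y + ?b))"
      unfolding nb by (rule frac)
    also have "(y + ?a) * (z - ?b) = (z - ?a) * (y + ?b) + (z + y) * (?a - ?b)"
      by (simp add: algebra_simps)
    also have "\<dots> / ((z - ?a) * (y + ?b)) = 1 + q"
      using nz unfolding q_def r_def by (simp add: add_divide_distrib)
    finally show ?thesis .
  qed
  have "(1 + q) ^ m = (\<Sum>j\<le>m. of_nat (m choose j) * q ^ j)"
    using binomial_ring[of q 1 m] by (simp add: add.commute)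
  also have "\<dots> = 1 + (\<Sum>j<m. of_nat (m choose Suc j) * q ^ Suc j)"
    unfolding lessThan_Suc_atMost[symmetric] sum.lessThan_Suc_shift by simp
  finally have binom: "(1 + q) ^ m = 1 + (\<Sum>j<m. of_nat (m choose Suc j) * q ^ Suc j)" .
  \<comment> \<open>Each \<open>q ^ Suc j\<close> carries a factor \<open>z + y\<close>, so the
    division leaves a pole at \<open>y = - z\<close> only in the term of order 0.\<close>
  have pow: "(1 + q) ^ m / (z + y) = 1 / (z + y) + (\<Sum>j<m. of_nat (m choose Suc j) * (z + y) ^ j * r ^ Suc j)"
  proof -
    have "of_nat (m choose Suc j) * q ^ Suc j / (z + y) = of_nat (m choose Suc j) * (z + y) ^ j * r ^ Suc j" for j
    proof -
      have "q ^ Suc j = (z + y) * ((z + y) ^ j * r ^ Suc j)"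
        by (simp only: q_def power_mult_distrib power_Suc[of "z + y"] mult.assoc)
      then show ?thesis using nz(3) by simp
    qed
    then show ?thesis
      unfolding binom add_divide_distrib sum_divide_distrib by simp
  qed
  have exps: "exp (- (z ^ 3) / 3 + \<xi>2 * z) / exp (- ((- y) ^ 3) / 3 + \<xi>1 * (- y)) = cubic_phase \<xi>2 z * cubic_phase \<xi>1 y"
  proof -
    have "- ((- y) ^ 3) / 3 + \<xi>1 * (- y) = - (- (y ^ 3) / 3 + \<xi>1 * y)" by simp
    moreover have "exp u / exp (- v) = exp u * exp v" for u v :: complex
      by (simp add: exp_minus divide_inverse)
    ultimately show ?thesis by (simp only: cubic_phase_def)
  qed
  have summand: "cubic_phase \<xi>2 z * cubic_phase \<xi>1 y * (of_nat (m choose Suc j) * (z + y) ^ j * r ^ Suc j) =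
      (\<Sum>k\<le>j. coeff m a b j k * phi \<xi>2 (Suc j) k a z * phi \<xi>1 (Suc j) (j - k) (- of_real b) y)" for j
  proof -
    have "cubic_phase \<xi>2 z * cubic_phase \<xi>1 y * (of_nat (m choose Suc j) * (z + y) ^ j * r ^ Suc j) =
      (\<Sum>k\<le>j. cubic_phase \<xi>2 z * cubic_phase \<xi>1 y * (of_nat (m choose Suc j) * (of_nat (j choose k) * z ^ k * y ^ (j - k)) * r ^ Suc j))"
      by (simp only: binomial_ring sum_distrib_left sum_distrib_right)
    also have "\<dots> = (\<Sum>k\<le>j. coeff m a b j k * phi \<xi>2 (Suc j) k a z * phi \<xi>1 (Suc j) (j - k) (- of_real b) y)"
      unfolding r_def coeff_def phi_def power_divide power_mult_distrib by (intro sum.cong) simp_all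
    finally show ?thesis .
  qed
  have "integrand m \<xi>1 \<xi>2 a b z (- y) = cubic_phase \<xi>2 z * cubic_phase \<xi>1 y * ((1 + q) ^ m / (z + y))"
    unfolding integrand_def exps q[symmetric] by (simp only: power_mult_distrib diff_minus_eq_add)
  also have "\<dots> = cubic_phase \<xi>2 z * phi \<xi>1 1 0 (- z) y +
      (\<Sum>j<m. cubic_phase \<xi>2 z * cubic_phase \<xi>1 y * (of_nat (m choose Suc j) * (z + y) ^ j * r ^ Suc j))"
    unfolding pow by (simp add: distrib_left sum_distrib_left phi_def add.commute)
  finally show ?thesis by (simp only: summand expansion_def)
qed

lemma expansion_add_right:
  "expansion m a b P (\<lambda>j k. Q j k + R j k) = expansion m a b P Q + expansion m a b P R"
  by (simp add: expansion_def sum.distrib distrib_left)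

lemma expansion_add_left:
  "expansion m a b (\<lambda>j k. P j k + R j k) Q = expansion m a b P Q + expansion m a b R Q"
  by (simp add: expansion_def sum.distrib distrib_left distrib_right)

lemma has_infinite_integral_expansion:
  assumes "\<And>j k. has_infinite_integral \<gamma> (\<lambda>z. P z j k) (I j k)"
  shows "has_infinite_integral \<gamma> (\<lambda>z. expansion m a b (P z) Q) (expansion m a b I Q)"
    and "has_infinite_integral \<gamma> (\<lambda>z. expansion m a b Q (P z)) (expansion m a b Q I)"
proof -
  have "has_infinite_integral \<gamma> (\<lambda>z. coeff m a b j k * Q j k * P z j k) (coeff m a b j k * Q j k * I j k)" for j k
    by (intro has_infinite_integral_lmul assms)
  then show "has_infinite_integral \<gamma> (\<lambda>z. expansion m a b Q (P z)) (expansion m a b Q I)"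
    unfolding expansion_def by (intro has_infinite_integral_sum) auto
  then show "has_infinite_integral \<gamma> (\<lambda>z. expansion m a b (P z) Q) (expansion m a b I Q)"
    by (simp add: expansion_def mult.assoc mult.commute[of "Q _ _"])
qed

lemma has_contour_integral_expansion:
  assumes "\<And>j k. ((\<lambda>z. P z j k) has_contour_integral I j k) \<gamma>"
  shows "((\<lambda>z. expansion m a b (P z) Q) has_contour_integral expansion m a b I Q) \<gamma>"
    and "((\<lambda>z. expansion m a b Q (P z)) has_contour_integral expansion m a b Q I) \<gamma>"
proof -
  have "((\<lambda>z. coeff m a b j k * Q j k * P z j k) has_contour_integral (coeff m a b j k * Q j k * I j k)) \<gamma>" for j k
    by (intro has_contour_integral_lmul assms)
  then show "((\<lambda>z. expansion m a b Q (P z)) has_contour_integral (expansion m a b Q I)) \<gamma>"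
    unfolding expansion_def by (intro has_contour_integral_sum) auto
  then show "((\<lambda>z. expansion m a b (P z) Q) has_contour_integral (expansion m a b I Q)) \<gamma>"
    by (simp add: expansion_def mult.assoc mult.commute[of "Q _ _"])
qed

text \<open>The two poles of the inner integrand may lie on different sides: \<open>\<sigma>\<close>
  records the side of \<open>- z\<close> and \<open>\<tau>\<close> that of \<open>- b\<close>. The
  overall minus sign comes from \<open>dw = - dy\<close>.\<close>

lemma inner_integral_curve:
  fixes \<gamma> :: "real \<Rightarrow> complex" and a b :: real
  defines "\<eta> \<equiv> (\<lambda>t. - \<gamma> t)"
  assumes \<eta>: "tail_curve \<eta>" and \<sigma>: "\<sigma> = 1 \<or> \<sigma> = -1" "reaches \<sigma> \<eta> (- z)"
    and \<tau>: "\<tau> = 1 \<or> \<tau> = -1" "reaches \<tau> \<eta> (- of_real b)" and za: "z \<noteq> of_real a"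
  shows "infinite_contour_integral \<gamma> (\<lambda>w. integrand m \<xi>1 \<xi>2 a b z w) =
    - (cubic_phase \<xi>2 z * phi_integral \<sigma> \<xi>1 1 0 (- z) +
      expansion m a b (\<lambda>j k. phi \<xi>2 (Suc j) k a z) (\<lambda>j k. phi_integral \<tau> \<xi>1 (Suc j) (j - k) (- of_real b)))"
proof -
  have "has_infinite_integral \<eta> (\<lambda>y. cubic_phase \<xi>2 z * phi \<xi>1 1 0 (- z) y +
      expansion m a b (\<lambda>j k. phi \<xi>2 (Suc j) k a z) (\<lambda>j k. phi \<xi>1 (Suc j) (j - k) (- of_real b) y))
    (cubic_phase \<xi>2 z * phi_integral \<sigma> \<xi>1 1 0 (- z) +
      expansion m a b (\<lambda>j k. phi \<xi>2 (Suc j) k a z) (\<lambda>j k. phi_integral \<tau> \<xi>1 (Suc j) (j - k) (- of_real b)))"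
    by (intro has_infinite_integral_add has_infinite_integral_lmul has_infinite_integral_expansion(2)
      has_infinite_integral_phi \<eta> \<sigma> \<tau>)
  then have "has_infinite_integral \<eta> (\<lambda>y. integrand m \<xi>1 \<xi>2 a b z (- y))
    (cubic_phase \<xi>2 z * phi_integral \<sigma> \<xi>1 1 0 (- z) +
      expansion m a b (\<lambda>j k. phi \<xi>2 (Suc j) k a z) (\<lambda>j k. phi_integral \<tau> \<xi>1 (Suc j) (j - k) (- of_real b)))"
  proof (rule has_infinite_integral_spike[where N = "{}"])
    fix t
    have "\<eta> t \<noteq> - z" "\<eta> t \<noteq> - of_real b"
      using reaches_notin_range[OF \<sigma>(2)] reaches_notin_range[OF \<tau>(2)] by (metis rangeI)+
    then show "cubic_phase \<xi>2 z * phi \<xi>1 1 0 (- z) (\<eta> t) +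
      expansion m a b (\<lambda>j k. phi \<xi>2 (Suc j) k a z) (\<lambda>j k. phi \<xi>1 (Suc j) (j - k) (- of_real b) (\<eta> t)) =
      integrand m \<xi>1 \<xi>2 a b z (- \<eta> t)"
      using integrand_expand[OF za] by simp
  qed simp
  then show ?thesis
    using infinite_integral_reflect[OF \<eta>[unfolded \<eta>_def], of "integrand m \<xi>1 \<xi>2 a b z"]
    by (simp only: has_infinite_integral_unique \<eta>_def)
qed

lemma has_contour_integral_phi:
  assumes "valid_path l" "pathfinish l = pathstart l" "p \<notin> path_image l"
  shows "(phi \<xi> j k p has_contour_integral
    2 * of_real pi * \<i> * (winding_number l p * residue (phi \<xi> j k p) p)) l"
proof -
  have "connected (UNIV :: complex set)" by (rule convex_connected[OF convex_UNIV])
  note res = Residue_theorem[OF open_UNIV this _ _ assms(1,2), of "{p}" "phi \<xi> j k p"]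
  have "contour_integral l (phi \<xi> j k p) =
      2 * of_real pi * \<i> * (winding_number l p * residue (phi \<xi> j k p) p)"
  proof -
    have "path_image l \<subseteq> UNIV - {p}" using assms(3) by blast
    then show ?thesis using res phi_holomorphic[of \<xi> j k p] by (simp add: Compl_eq_Diff_UNIV)
  qed
  moreover have "phi \<xi> j k p contour_integrable_on l"
    using assms by (intro contour_integrable_holomorphic_simple[OF phi_holomorphic]) auto
  ultimately show ?thesis using has_contour_integral_integral by metis
qed

text \<open>Negation is the rotation by \<open>pi\<close>, so it preserves orientation.\<close>

lemma winding_number_reflect:
  assumes "valid_path l" "z \<notin> path_image l"
  shows "winding_number (uminus \<circ> l) (- z) = winding_number l z"
proof -
  have "- z \<notin> path_image (uminus \<circ> l)" using assms(2) by (auto simp: path_image_def)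
  then have "winding_number (uminus \<circ> l) (- z) =
      1 / (2 * pi * \<i>) * contour_integral (uminus \<circ> l) (\<lambda>w. 1 / (w - (- z)))"
    by (intro winding_number_valid_path valid_path_negatepath assms)
  also have "contour_integral (uminus \<circ> l) (\<lambda>w. 1 / (w - (- z))) = contour_integral l (\<lambda>w. 1 / (w - z))"
  proof -
    have "- (1 / (- w - (- z))) = 1 / (w - z)" for w
      by (metis divide_minus_right minus_diff_eq minus_diff_minus)
    then show ?thesis
      using contour_integral_negatepath[OF assms(1)] contour_integral_neg[of l "\<lambda>w. 1 / (- w - (- z))"]
      by simp
  qed
  also have "1 / (2 * pi * \<i>) * \<dots> = winding_number l z"
    using winding_number_valid_path[OF assms] by simp
  finally show ?thesis .
qed

definition phi_residue :: "real \<Rightarrow> nat \<Rightarrow> nat \<Rightarrow> complex \<Rightarrow> complex"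
  where "phi_residue \<xi> j k p = 2 * of_real pi * \<i> * residue (phi \<xi> j k p) p"

lemma phi_integral_add_residue:
  "phi_integral 1 \<xi> j k (of_real p) + phi_residue \<xi> j k (of_real p) = phi_integral (-1) \<xi> j k (of_real p)"
  using phi_integral_residue[of \<xi> j k p] by (simp add: phi_residue_def algebra_simps)

text \<open>The Airy pole \<open>- z\<close> has winding number zero and contributes nothing, which
  leaves the residues at \<open>- b\<close>.\<close>

lemma inner_integral_loop:
  fixes a b :: real
  assumes l: "valid_path l" "pathfinish l = pathstart l"
    and z: "z \<notin> path_image l" "winding_number l z = 0" "z \<noteq> of_real a"
    and b: "of_real b \<notin> path_image l" "winding_number l (of_real b) = 1"
  shows "contour_integral l (\<lambda>w. integrand m \<xi>1 \<xi>2 a b z w) =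
    - expansion m a b (\<lambda>j k. phi \<xi>2 (Suc j) k a z) (\<lambda>j k. phi_residue \<xi>1 (Suc j) (j - k) (- of_real b))"
proof -
  let ?l = "uminus \<circ> l"
  have l': "valid_path ?l" "pathfinish ?l = pathstart ?l"
    using l by (auto intro: valid_path_negatepath simp: pathfinish_def pathstart_def)
  have im: "- z \<notin> path_image ?l" "- of_real b \<notin> path_image ?l"
    using z(1) b(1) by (auto simp: path_image_def)
  have w: "winding_number ?l (- z) = 0" "winding_number ?l (- of_real b) = 1"
    using winding_number_reflect[OF l(1)] z b by auto
  have 0: "(phi \<xi>1 1 0 (- z) has_contour_integral 0) ?l"
    using has_contour_integral_phi[OF l' im(1), of \<xi>1 1 0] w(1) by simp
  have 1: "(phi \<xi>1 j k (- of_real b) has_contour_integral phi_residue \<xi>1 j k (- of_real b)) ?l" for j k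
    using has_contour_integral_phi[OF l' im(2), of \<xi>1 j k] w(2) by (simp add: phi_residue_def)
  let ?I = "expansion m a b (\<lambda>j k. phi \<xi>2 (Suc j) k a z) (\<lambda>j k. phi_residue \<xi>1 (Suc j) (j - k) (- of_real b))"
  have "((\<lambda>y. cubic_phase \<xi>2 z * phi \<xi>1 1 0 (- z) y +
      expansion m a b (\<lambda>j k. phi \<xi>2 (Suc j) k a z) (\<lambda>j k. phi \<xi>1 (Suc j) (j - k) (- of_real b) y))
    has_contour_integral (cubic_phase \<xi>2 z * 0 + ?I)) ?l"
    by (intro has_contour_integral_add has_contour_integral_lmul has_contour_integral_expansion(2) 0 1)
  moreover have "cubic_phase \<xi>2 z * phi \<xi>1 1 0 (- z) y +
      expansion m a b (\<lambda>j k. phi \<xi>2 (Suc j) k a z) (\<lambda>j k. phi \<xi>1 (Suc j) (j - k) (- of_real b) y) =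
      integrand m \<xi>1 \<xi>2 a b z (- y)" if "y \<in> path_image ?l" for y
  proof -
    have "y \<noteq> - z" "y \<noteq> - of_real b" using im that by auto
    then show ?thesis using integrand_expand[OF z(3)] by simp
  qed
  ultimately have "((\<lambda>y. integrand m \<xi>1 \<xi>2 a b z (- y)) has_contour_integral (cubic_phase \<xi>2 z * 0 + ?I)) ?l"
    by (rule has_contour_integral_eq)
  then have "contour_integral ?l (\<lambda>y. integrand m \<xi>1 \<xi>2 a b z (- y)) = ?I"
    by (simp add: contour_integral_unique)
  then have "- contour_integral l (\<lambda>w. integrand m \<xi>1 \<xi>2 a b z w) = ?I"
    using contour_integral_negatepath[OF l(1), of "\<lambda>y. integrand m \<xi>1 \<xi>2 a b z (- y)"] by simp
  then show ?thesis by (metis minus_minus)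
qed

section \<open>Relative position of the contours\<close>

lemma tail_curve_Re_unbounded:
  assumes "tail_curve \<gamma>"
  shows "\<exists>s\<ge>t. Re (\<gamma> s) < M" and "\<exists>s\<le>t. Re (\<gamma> s) < M"
proof -
  obtain T where T: "\<And>t. t \<ge> T \<Longrightarrow> \<gamma> t \<in> near (cis (2 * pi / 3)) (1/4) t \<and> \<gamma> (-t) \<in> near (cis (- 2 * pi / 3)) (1/4) t"
    using tail_curve_near[OF assms, of "1/4"] by auto
  define s where "s = max T (4 * \<bar>M\<bar> + \<bar>t\<bar> + 1)"
  have s: "s \<ge> T" "s \<ge> t" "-s \<le> t" "s \<ge> 4 * \<bar>M\<bar> + \<bar>t\<bar> + 1" by (auto simp: s_def)
  then have "- s / 4 < - \<bar>M\<bar>" by simp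
  then have sM: "- s / 4 < M" using abs_ge_minus_self[of M] by simp
  have "Re (\<gamma> s) \<le> - s / 4" "Re (\<gamma> (-s)) \<le> - s / 4"
    using near_Re[of "\<gamma> s" "1/4" s] near_Re[of "\<gamma> (-s)" "1/4" s] T[OF s(1)] by auto
  then show "\<exists>s\<ge>t. Re (\<gamma> s) < M" "\<exists>s\<le>t. Re (\<gamma> s) < M"
    using s(2,3) sM by (meson le_less_trans)+
qed

lemma tail_curve_Re_bounded_above:
  assumes "tail_curve \<gamma>"
  obtains M where "\<And>t. Re (\<gamma> t) \<le> M"
proof -
  obtain T where T: "T > 0" "\<And>t. t \<ge> T \<Longrightarrow> \<gamma> t \<in> near (cis (2 * pi / 3)) (1/2) t \<and> \<gamma> (-t) \<in> near (cis (- 2 * pi / 3)) (1/2) t"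
    using tail_curve_near[OF assms, of "1/2"] by auto
  have "compact (\<gamma> ` {-T..T})"
    using tail_curve_continuous[OF assms] by (intro compact_continuous_image) auto
  then obtain B where B: "\<forall>z\<in>\<gamma> ` {-T..T}. norm z \<le> B"
    using compact_imp_bounded bounded_iff by meson
  show ?thesis
  proof (rule that)
    fix t
    show "Re (\<gamma> t) \<le> max B 0"
    proof (cases "t \<in> {-T..T}")
      case True
      then show ?thesis using B complex_Re_le_cmod[of "\<gamma> t"] by (meson imageI max.coboundedI1 order_trans)
    next
      case False
      then have "\<bar>t\<bar> \<ge> T" by auto
      then have "\<gamma> t \<in> near (cis (2 * pi / 3)) (1/2) \<bar>t\<bar> \<union> near (cis (- 2 * pi / 3)) (1/2) \<bar>t\<bar>"
        using T(2)[of "\<bar>t\<bar>"] by (cases "t \<ge> 0") auto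
      from near_Re[OF this] show ?thesis by simp
    qed
  qed
qed

text \<open>The real part of \<open>\<delta>\<close> is bounded below, so \<open>\<delta>\<close>
  misses a left half-plane \<open>H\<close>, while the tails of \<open>\<gamma>\<close> enter every
  left half-plane. The union of \<open>range \<gamma>\<close> and \<open>H\<close> is thus a
  connected set that avoids \<open>\<delta>\<close> and contains the far negative axis.\<close>

lemma range_subset_left_of:
  assumes \<gamma>: "tail_curve \<gamma>" and \<delta>: "tail_curve (\<lambda>t. - \<delta> t)" and dis: "range \<gamma> \<inter> range \<delta> = {}"
  shows "range \<gamma> \<subseteq> left_of \<delta>"
proof
  fix z assume z: "z \<in> range \<gamma>"
  obtain M where M: "\<And>t. Re (- \<delta> t) \<le> M" using tail_curve_Re_bounded_above[OF \<delta>] by blast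
  define H where "H = {w. Re w < - M}"
  obtain s where s: "\<gamma> s \<in> H" using tail_curve_Re_unbounded(1)[OF \<gamma>, of 0 "-M"] unfolding H_def by blast
  have "\<delta> t \<notin> H" for t using M[of t] by (simp add: H_def)
  then have sub: "range \<gamma> \<union> H \<subseteq> - range \<delta>" using dis by blast
  have con: "connected (range \<gamma> \<union> H)"
  proof (rule connected_Un)
    show "connected (range \<gamma>)"
      by (intro connected_continuous_image tail_curve_continuous[OF \<gamma>]) simp
    show "connected H" unfolding H_def by (intro convex_connected convex_halfspace_Re_lt)
    show "range \<gamma> \<inter> H \<noteq> {}" using s by blast
  qed
  have "connected_component (- range \<delta>) z (of_real x)" if "x < - M" for x
    unfolding connected_component_def using con sub z that
    by (intro exI[of _ "range \<gamma> \<union> H"]) (auto simp: H_def)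
  then show "z \<in> left_of \<delta>"
    unfolding left_of_def eventually_at_bot_dense by blast
qed

text \<open>By injectivity \<open>c\<close> lies on at most one of the two half-curves that start at
  \<open>L t\<close>. The other runs to infinity without meeting \<open>A\<close>, which puts
  \<open>L t\<close> into an unbounded component.\<close>

lemma curve_point_outside_loop:
  assumes L: "tail_curve L" "inj L" and dis: "range L \<inter> A \<subseteq> {c}" and t: "L t \<noteq> c"
  shows "L t \<in> outside A"
proof -
  have ray: "L t \<in> outside A" if S: "connected S" "t \<in> S" "c \<notin> L ` S" "\<And>M. \<exists>s\<in>S. Re (L s) < M" for S
  proof -
    have "L ` S \<subseteq> - A" using dis S(3) by blast
    moreover have "connected (L ` S)"
      by (intro connected_continuous_image tail_curve_continuous[OF L(1)] S)
    ultimately have "L ` S \<subseteq> connected_component_set (- A) (L t)"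
      using S(2) by (intro connected_component_maximal) auto
    moreover have "\<not> bounded (L ` S)"
    proof
      assume "bounded (L ` S)"
      then obtain B where "\<And>s. s \<in> S \<Longrightarrow> norm (L s) \<le> B" unfolding bounded_iff by blast
      moreover obtain s where "s \<in> S" "Re (L s) < - B" using S(4) by blast
      ultimately show False using abs_Re_le_cmod[of "L s"] by fastforce
    qed
    ultimately have "\<not> bounded (connected_component_set (- A) (L t))"
      using bounded_subset by blast
    then show ?thesis using \<open>L ` S \<subseteq> - A\<close> S(2) unfolding outside_def by blast
  qed
  show ?thesis
  proof (cases "c \<in> L ` {t..}")
    case True
    then obtain u where "u \<ge> t" "L u = c" by auto
    then have "u > t" using t by (cases "u = t") auto
    then have "c \<notin> L ` {..t}" using \<open>L u = c\<close> L(2) unfolding inj_def by force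
    then show ?thesis
      using tail_curve_Re_unbounded(2)[OF L(1), of t] by (intro ray[of "{..t}"]) auto
  next
    case False
    then show ?thesis
      using tail_curve_Re_unbounded(1)[OF L(1), of t] by (intro ray[of "{t..}"]) auto
  qed
qed

text \<open>If the loop is restarted at \<open>c\<close>, removing \<open>c\<close> removes just the
  common endpoint of a simple path.\<close>

lemma connected_simple_loop_minus_point:
  assumes "simple_path l" "pathfinish l = pathstart l"
  shows "connected (path_image l - {c})"
proof (cases "c \<in> path_image l")
  case False
  then show ?thesis using assms(1) by (simp add: connected_path_image simple_path_imp_path)
next
  case True
  then obtain t where t: "t \<in> {0..1}" "l t = c" unfolding path_image_def by blast
  have "pathstart (shiftpath t l) = c" "pathfinish (shiftpath t l) = c"
    using t assms(2) by (auto simp: pathstart_shiftpath pathfinish_shiftpath)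
  moreover have "path_image (shiftpath t l) = path_image l"
    using t assms(2) by (intro path_image_shiftpath) auto
  moreover have "simple_path (shiftpath t l)"
    using t assms by (intro simple_path_shiftpath) auto
  ultimately show ?thesis using connected_simple_path_endless[of "shiftpath t l"] by simp
qed

text \<open>Suppose a point of \<open>l\<close> other than \<open>c\<close> is not outside
  \<open>l'\<close>. Since \<open>l\<close> without \<open>c\<close> is connected and avoids
  \<open>l'\<close>, none of it is outside \<open>l'\<close>. Then the outside of \<open>l'\<close>
  without \<open>c\<close> avoids \<open>l\<close>; it is connected, unbounded and contains
  \<open>a\<close>, so \<open>a\<close> would be outside \<open>l\<close>.\<close>

lemma loop_point_outside_loop:
  fixes l l' :: "real \<Rightarrow> complex"
  assumes l: "simple_path l" "pathfinish l = pathstart l" and l': "path l'"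
    and dis: "path_image l \<inter> path_image l' \<subseteq> {c}"
    and a: "a \<in> inside (path_image l)" "a \<in> outside (path_image l')" "a \<noteq> c"
    and z: "z \<in> path_image l" "z \<noteq> c"
  shows "z \<in> outside (path_image l')"
proof (rule ccontr)
  assume nz: "z \<notin> outside (path_image l')"
  let ?O = "outside (path_image l')"
  have bd: "bounded (path_image l')" "closed (path_image l')"
    using l' by (auto intro: bounded_path_image closed_path_image)
  have "?O \<inter> (path_image l - {c}) = {}"
  proof (rule ccontr)
    assume "?O \<inter> (path_image l - {c}) \<noteq> {}"
    then obtain y where y: "y \<in> ?O" "y \<in> path_image l - {c}" by blast
    have "connected_component (- path_image l') y z"
      unfolding connected_component_def
      using connected_simple_loop_minus_point[OF l, of c] dis y z
      by (intro exI[of _ "path_image l - {c}"]) auto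
    then show False using outside_same_component y(1) nz by blast
  qed
  then have sub: "?O - {c} \<subseteq> - path_image l" by blast
  have "connected (?O - {c})"
    using connected_open_delete[OF open_outside[OF bd(2)] connected_outside[OF bd(1)]] by simp
  then have "?O - {c} \<subseteq> connected_component_set (- path_image l) a"
    using a sub by (intro connected_component_maximal) auto
  moreover have "\<not> bounded (?O - {c})"
    using unbounded_outside[OF bd(1)] bounded_insert[of c "?O - {c}"] by simp
  ultimately have "\<not> bounded (connected_component_set (- path_image l) a)"
    using bounded_subset by blast
  then have "a \<in> outside (path_image l)" using a sub unfolding outside_def by blast
  then show False using a(1) inside_Int_outside by blast
qed

lemma simple_path_finite_preimage:
  assumes "simple_path l"
  shows "finite {t \<in> {0..1}. l t = c}"
proof (cases "\<exists>t\<in>{0..1}. l t = c")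
  case True
  then obtain u where u: "u \<in> {0..1}" "l u = c" by blast
  \<comment> \<open>Simplicity still lets a closed path take the value \<open>c\<close> at both 0
    and 1.\<close>
  have "{t \<in> {0..1}. l t = c} \<subseteq> {u, 0, 1}"
    using assms u unfolding simple_path_def loop_free_def by blast
  then show ?thesis using finite_subset by blast
next
  case False
  then have empty: "{t \<in> {0..1}. l t = c} = {}" by blast
  show ?thesis unfolding empty by simp
qed

lemma has_contour_integral_spike_point:
  assumes "(f has_contour_integral I) l" "simple_path l"
    and "\<And>z. z \<in> path_image l \<Longrightarrow> z \<noteq> c \<Longrightarrow> g z = f z"
  shows "(g has_contour_integral I) l"
  using assms(1) unfolding has_contour_integral_def
  by (rule has_integral_spike_finite[OF simple_path_finite_preimage[OF assms(2), of c], rotated])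
    (use assms(3) in \<open>auto simp: path_image_def\<close>)

section \<open>The analytic continuation\<close>

text \<open>Side \<open>-1\<close> for both poles means that \<open>a\<close> lies to the left of
  the outer contour and \<open>b\<close> to the right of the inner one, as for \<open>a < b\<close>.
  The minus sign in front comes from reflecting the inner variable.\<close>

definition kernel_continuation :: "nat \<Rightarrow> real \<Rightarrow> real \<Rightarrow> complex \<times> complex \<Rightarrow> complex"
  where "kernel_continuation m \<xi>1 \<xi>2 = (\<lambda>(a, b). - (1 / (2 * complex_of_real pi * \<i>)^2) *
    (airy_part \<xi>1 \<xi>2 + expansion m a b (\<lambda>j k. phi_integral (-1) \<xi>2 (Suc j) k a)
      (\<lambda>j k. phi_integral (-1) \<xi>1 (Suc j) (j - k) (- b))))"

lemma kernel_K_eq: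
  assumes "contours a b \<Gamma>a \<Gamma>b"
  shows "kernel_K m \<xi>1 \<xi>2 a b \<Gamma>a \<Gamma>b = kernel_continuation m \<xi>1 \<xi>2 (of_real a, of_real b)"
proof -
  let ?\<eta> = "\<lambda>t. - \<Gamma>b t"
  let ?Q = "\<lambda>j k. phi_integral (-1) \<xi>1 (Suc j) (j - k) (- of_real b)"
  let ?g = "\<lambda>z. cubic_phase \<xi>2 z * phi_integral 1 \<xi>1 1 0 (- z) +
    expansion m a b (\<lambda>j k. phi \<xi>2 (Suc j) k a z) ?Q"
  let ?I = "airy_part \<xi>1 \<xi>2 + expansion m a b (\<lambda>j k. phi_integral (-1) \<xi>2 (Suc j) k a) ?Q"
  have \<gamma>: "tail_curve \<Gamma>a" and \<eta>: "tail_curve ?\<eta>"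
    using assms infinite_curve_imp_tail_curve infinite_curve_reflect unfolding contours_def by auto
  have a: "reaches (-1) \<Gamma>a (of_real a)" and b: "reaches (-1) ?\<eta> (- of_real b)"
    using assms left_of_imp_reaches[OF \<gamma>] right_of_imp_reaches_reflect[OF \<eta>] unfolding contours_def by auto
  have inner: "infinite_contour_integral \<Gamma>b (\<lambda>w. integrand m \<xi>1 \<xi>2 a b z w) = - ?g z" if z: "z \<in> range \<Gamma>a" for z
  proof -
    \<comment> \<open>Disjointness and the directions at infinity put the whole outer contour to the
      left of the inner one, so the Airy pole is on the same side for all \<open>z\<close>.\<close>
    have "z \<in> left_of \<Gamma>b"
      using range_subset_left_of[OF \<gamma> \<eta>] assms z unfolding contours_def by blast
    then have "reaches 1 ?\<eta> (- z)" by (rule left_of_imp_reaches_reflect[OF \<eta>])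
    moreover have "z \<noteq> of_real a" using reaches_notin_range[OF a] z by blast
    ultimately show ?thesis using b by (intro inner_integral_curve \<eta>) auto
  qed
  have "has_infinite_integral \<Gamma>a ?g ?I"
    using a by (intro has_infinite_integral_add has_infinite_integral_airy_part \<gamma>
      has_infinite_integral_expansion(1) has_infinite_integral_phi) auto
  from has_infinite_integral_lmul[OF this, of "-1"]
  have "has_infinite_integral \<Gamma>a (\<lambda>z. infinite_contour_integral \<Gamma>b (\<lambda>w. integrand m \<xi>1 \<xi>2 a b z w)) (-1 * ?I)"
    by (rule has_infinite_integral_spike[where N = "{}"]) (simp_all add: inner)
  from has_infinite_integral_unique[OF this] show ?thesis
    by (simp only: kernel_K_def kernel_continuation_def prod.case mult_minus_left mult_minus_right mult_1)
qed

text \<open>The inner integral has the same expansion part on \<open>L\<close> and on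
  \<open>la\<close>. Its Airy part is on side \<open>1\<close> along \<open>L\<close>, which lies to
  the left of \<open>L'\<close>, and on side \<open>-1\<close> along \<open>la\<close>, which lies
  to the right.\<close>

lemma kernel_K_tilde_eq:
  assumes "contours_tilde a b L la L' lb"
  shows "kernel_K_tilde m \<xi>1 \<xi>2 a b L la L' lb = kernel_continuation m \<xi>1 \<xi>2 (of_real a, of_real b)"
proof -
  let ?\<eta> = "\<lambda>t. - L' t"
  let ?a = "complex_of_real a" and ?b = "complex_of_real b"
  have A: "infinite_curve (cis (- 2 * pi / 3)) (cis (2 * pi / 3)) L" "crosses_between b a L"
      "loop_around ?a ?b la" "infinite_curve (cis (pi / 3)) (cis (- pi / 3)) L'" "crosses_between b a L'"
      "loop_around ?b ?a lb"
    and "\<exists>c. b < c \<and> c < a \<and> range L \<inter> path_image lb \<subseteq> {complex_of_real c} \<and>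
      path_image la \<inter> path_image lb \<subseteq> {complex_of_real c} \<and>
      range L - {complex_of_real c} \<subseteq> left_of L' \<and>
      path_image la - {complex_of_real c} \<subseteq> right_of L'"
    using assms unfolding contours_tilde_def by (simp_all only:) (elim conjE exE, intro exI conjI)
  then obtain c where c: "b < c" "c < a"
      "range L \<inter> path_image lb \<subseteq> {complex_of_real c}"
      "path_image la \<inter> path_image lb \<subseteq> {complex_of_real c}"
      "range L - {complex_of_real c} \<subseteq> left_of L'"
      "path_image la - {complex_of_real c} \<subseteq> right_of L'"
    by (elim exE conjE)
  have la: "valid_path la" "simple_path la" "pathfinish la = pathstart la" "?a \<in> inside (path_image la)"
    "winding_number la ?a = 1"
    using A(3) by (simp_all only: loop_around_def)
  have lb: "valid_path lb" "simple_path lb" "pathfinish lb = pathstart lb" "?b \<in> inside (path_image lb)"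
    "winding_number lb ?b = 1" "?a \<in> outside (path_image lb)"
    using A(6) by (simp_all only: loop_around_def)
  have ala: "?a \<notin> path_image la" and blb: "?b \<notin> path_image lb"
    using la(4) lb(4) unfolding inside_def by simp_all
  have \<gamma>: "tail_curve L" "inj L" and \<eta>: "tail_curve ?\<eta>"
    using infinite_curve_imp_tail_curve[OF A(1)] infinite_curve_reflect[OF A(4)] A(1)
    by (simp_all only: infinite_curve_def)
  have a: "reaches 1 L ?a"
    using A(2) unfolding crosses_between_def by (intro right_of_imp_reaches[OF \<gamma>(1)]) simp
  have b: "reaches 1 ?\<eta> (- ?b)"
    using A(5) unfolding crosses_between_def by (intro left_of_imp_reaches_reflect[OF \<eta>]) simp
  let ?Q = "\<lambda>j k. phi_integral (-1) \<xi>1 (Suc j) (j - k) (- ?b)"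
  let ?R = "\<lambda>z. expansion m a b (\<lambda>j k. phi \<xi>2 (Suc j) k a z) ?Q"
  let ?g = "\<lambda>s z. cubic_phase \<xi>2 z * phi_integral s \<xi>1 1 0 (- z) + ?R z"
  let ?inner = "\<lambda>z. union_contour_integral L' lb (\<lambda>w. integrand m \<xi>1 \<xi>2 a b z w)"
  have res: "phi_integral 1 \<xi> j k (- ?b) + phi_residue \<xi> j k (- ?b) = phi_integral (-1) \<xi> j k (- ?b)" for \<xi> j k
    using phi_integral_add_residue[of \<xi> j k "- b"] by simp
  have inner: "?inner z = - ?g s z"
    if z: "z \<in> outside (path_image lb)" "z \<noteq> ?a" and s: "s = 1 \<or> s = -1" "reaches s ?\<eta> (- z)" for z s
  proof -
    have zlb: "z \<notin> path_image lb" "winding_number lb z = 0"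
      using z(1) winding_number_zero_in_outside[OF valid_path_imp_path[OF lb(1)] lb(3)] by (auto simp: outside_def)
    have "?inner z = - (cubic_phase \<xi>2 z * phi_integral s \<xi>1 1 0 (- z) +
        expansion m a b (\<lambda>j k. phi \<xi>2 (Suc j) k a z) (\<lambda>j k. phi_integral 1 \<xi>1 (Suc j) (j - k) (- ?b))) -
        expansion m a b (\<lambda>j k. phi \<xi>2 (Suc j) k a z) (\<lambda>j k. phi_residue \<xi>1 (Suc j) (j - k) (- ?b))"
      unfolding union_contour_integral_def
      using inner_integral_curve[OF \<eta> s _ b z(2)] inner_integral_loop[OF lb(1,3) zlb z(2) blb lb(5)] by simp
    also have "\<dots> = - ?g s z"
      unfolding res[symmetric] expansion_add_right by simp
    finally show ?thesis .
  qed
  have innerL: "?inner (L t) = - ?g 1 (L t)" if "L t \<noteq> of_real c" for t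
  proof (rule inner)
    show "L t \<in> outside (path_image lb)" by (rule curve_point_outside_loop[OF \<gamma> c(3) that])
    show "L t \<noteq> ?a" using reaches_notin_range[OF a] by (metis rangeI)
    show "reaches 1 ?\<eta> (- L t)" using c(5) that by (intro left_of_imp_reaches_reflect[OF \<eta>]) auto
  qed simp
  \<comment> \<open>\<open>L\<close> is injective, so it passes through \<open>c\<close> for at most
    one parameter, where the value of the inner integral is left open.\<close>
  have finL: "finite {t. L t = of_real c}"
    using finite_vimageI[OF _ \<gamma>(2), of "{complex_of_real c}"] by (simp add: vimage_def)
  have "has_infinite_integral L (\<lambda>z. -1 * ?g 1 z)
      (-1 * (airy_part \<xi>1 \<xi>2 + expansion m a b (\<lambda>j k. phi_integral 1 \<xi>2 (Suc j) k a) ?Q))"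
    using a by (intro has_infinite_integral_lmul has_infinite_integral_add has_infinite_integral_airy_part \<gamma>
      has_infinite_integral_expansion(1) has_infinite_integral_phi) auto
  from this finL have "has_infinite_integral L ?inner
      (-1 * (airy_part \<xi>1 \<xi>2 + expansion m a b (\<lambda>j k. phi_integral 1 \<xi>2 (Suc j) k a) ?Q))"
  proof (rule has_infinite_integral_spike)
    fix t assume "t \<notin> {t. L t = of_real c}"
    then have "L t \<noteq> of_real c" by simp
    from innerL[OF this] show "-1 * ?g 1 (L t) = ?inner (L t)" by (simp only: mult_minus1)
  qed
  then have 1: "infinite_contour_integral L ?inner =
      - (airy_part \<xi>1 \<xi>2 + expansion m a b (\<lambda>j k. phi_integral 1 \<xi>2 (Suc j) k a) ?Q)"
    using has_infinite_integral_unique[of L ?inner] by (simp only: mult_minus1)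
  have innerl: "?inner z = - ?g (-1) z" if z: "z \<in> path_image la" "z \<noteq> of_real c" for z
  proof (rule inner)
    show "z \<in> outside (path_image lb)"
      using c(2) by (intro loop_point_outside_loop[OF la(2,3) valid_path_imp_path[OF lb(1)] c(4) la(4) lb(6) _ z]) auto
    show "z \<noteq> ?a" using ala z(1) by blast
    show "reaches (-1) ?\<eta> (- z)" using c(6) z by (intro right_of_imp_reaches_reflect[OF \<eta>]) auto
  qed simp
  have "((\<lambda>z. -1 * ?g (-1) z) has_contour_integral
      (-1 * (0 + expansion m a b (\<lambda>j k. phi_residue \<xi>2 (Suc j) k a) ?Q))) la"
  proof (intro has_contour_integral_lmul has_contour_integral_add has_contour_integral_expansion(1))
    \<comment> \<open>The Airy part of the inner integral, known only on the loop, is there the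
      restriction of an entire function of \<open>z\<close>; Cauchy's theorem makes its integral
      vanish.\<close>
    show "((\<lambda>z. cubic_phase \<xi>2 z * phi_integral (-1) \<xi>1 1 0 (- z)) has_contour_integral 0) la"
      using la by (intro Cauchy_theorem_global[OF open_UNIV cubic_phase_phi_integral_holomorphic]) auto
    show "(phi \<xi>2 (Suc j) k a has_contour_integral phi_residue \<xi>2 (Suc j) k a) la" for j k
      using has_contour_integral_phi[OF la(1,3) ala, of \<xi>2 "Suc j" k] la(5) by (simp add: phi_residue_def)
  qed
  from this la(2) have "(?inner has_contour_integral
      (-1 * (0 + expansion m a b (\<lambda>j k. phi_residue \<xi>2 (Suc j) k a) ?Q))) la"
  proof (rule has_contour_integral_spike_point[where c = "of_real c"])
    show "?inner z = -1 * ?g (-1) z" if "z \<in> path_image la" "z \<noteq> of_real c" for z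
      using innerl[OF that] by (simp only: mult_minus1)
  qed
  then have 2: "contour_integral la ?inner = - expansion m a b (\<lambda>j k. phi_residue \<xi>2 (Suc j) k a) ?Q"
    using contour_integral_unique[of ?inner] by (simp only: mult_minus1 add_0)
  have "union_contour_integral L la ?inner =
      - (airy_part \<xi>1 \<xi>2 + expansion m a b (\<lambda>j k. phi_integral (-1) \<xi>2 (Suc j) k a) ?Q)"
    unfolding union_contour_integral_def[of L la] 1 2 phi_integral_add_residue[symmetric] expansion_add_left by simp
  then show ?thesis
    by (simp only: kernel_K_tilde_def kernel_continuation_def prod.case mult_minus_left mult_minus_right)
qed

section \<open>Complex differentiability in two variables\<close>

definition differentiable2 :: "(complex \<times> complex \<Rightarrow> complex) \<Rightarrow> complex \<times> complex \<Rightarrow> bool"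
  where "differentiable2 F z \<longleftrightarrow> (\<exists>p q. (F has_derivative (\<lambda>(h, k). p * h + q * k)) (at z))"

lemma differentiable2_const: "differentiable2 (\<lambda>_. c) z"
  unfolding differentiable2_def by (intro exI[of _ 0]) (auto simp: case_prod_unfold)

lemma differentiable2_add:
  assumes "differentiable2 F z" "differentiable2 G z"
  shows "differentiable2 (\<lambda>x. F x + G x) z"
proof -
  obtain p q p' q' where "(F has_derivative (\<lambda>(h, k). p * h + q * k)) (at z)"
    "(G has_derivative (\<lambda>(h, k). p' * h + q' * k)) (at z)"
    using assms unfolding differentiable2_def by blast
  from has_derivative_add[OF this] show ?thesis
    unfolding differentiable2_def
    by (intro exI[of _ "p + p'"] exI[of _ "q + q'"]) (simp add: case_prod_unfold algebra_simps)
qed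

lemma differentiable2_mult:
  assumes "differentiable2 F z" "differentiable2 G z"
  shows "differentiable2 (\<lambda>x. F x * G x) z"
proof -
  obtain p q p' q' where "(F has_derivative (\<lambda>(h, k). p * h + q * k)) (at z)"
    "(G has_derivative (\<lambda>(h, k). p' * h + q' * k)) (at z)"
    using assms unfolding differentiable2_def by blast
  from has_derivative_mult[OF this] show ?thesis
    unfolding differentiable2_def
    by (intro exI[of _ "F z * p' + p * G z"] exI[of _ "F z * q' + q * G z"])
      (simp add: case_prod_unfold algebra_simps)
qed

lemma differentiable2_sum:
  assumes "\<And>i. i \<in> A \<Longrightarrow> differentiable2 (F i) z"
  shows "differentiable2 (\<lambda>x. \<Sum>i\<in>A. F i x) z"
  using assms by (induction A rule: infinite_finite_induct) (auto intro: differentiable2_const differentiable2_add)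

lemma differentiable2_power:
  "differentiable2 F z \<Longrightarrow> differentiable2 (\<lambda>x. F x ^ n) z"
  by (induction n) (auto intro: differentiable2_const differentiable2_mult)

lemma differentiable2_compose:
  assumes g: "g holomorphic_on UNIV"
  shows "differentiable2 (\<lambda>x. g (fst x)) z" and "differentiable2 (\<lambda>x. g (- snd x)) z"
proof -
  have d: "(g has_derivative (*) (deriv g w)) (at w)" for w
    using holomorphic_derivI[OF g open_UNIV] by (simp add: has_field_derivative_def)
  have "((\<lambda>x. g (fst x)) has_derivative (\<lambda>h. deriv g (fst z) * fst h)) (at z)"
    by (rule has_derivative_compose[OF has_derivative_fst[OF has_derivative_ident] d])
  then show "differentiable2 (\<lambda>x. g (fst x)) z"
    unfolding differentiable2_def by (intro exI[of _ "deriv g (fst z)"] exI[of _ 0]) (simp add: case_prod_unfold)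
  have "((\<lambda>x. g (- snd x)) has_derivative (\<lambda>h. deriv g (- snd z) * - snd h)) (at z)"
    by (rule has_derivative_compose[OF has_derivative_minus[OF has_derivative_snd[OF has_derivative_ident]] d])
  then show "differentiable2 (\<lambda>x. g (- snd x)) z"
    unfolding differentiable2_def by (intro exI[of _ 0] exI[of _ "- deriv g (- snd z)"]) (simp add: case_prod_unfold)
qed

text \<open>Up to constants each summand is a power of \<open>a - b\<close> times an entire function
  of \<open>a\<close> and an entire function of \<open>- b\<close>; the Airy part is constant. On
  the diagonal every summand vanishes, as \<open>Suc j\<close> is positive, and the Airy part is
  what remains.\<close>

lemma kernel_continuation_differentiable: "differentiable2 (kernel_continuation m \<xi>1 \<xi>2) z"
proof -
  have diff: "differentiable2 (\<lambda>x. fst x - snd x) z"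
    using differentiable2_add[OF differentiable2_compose(1)[OF holomorphic_on_ident]
      differentiable2_compose(2)[OF holomorphic_on_ident]] by simp
  show ?thesis
    unfolding kernel_continuation_def case_prod_unfold expansion_def coeff_def
    by (intro differentiable2_mult differentiable2_add differentiable2_sum differentiable2_power
      differentiable2_const diff differentiable2_compose phi_integral_holomorphic) simp_all
qed

theorem proposition6p1:
  fixes m :: nat and \<xi>1 \<xi>2 :: real
  assumes "m \<ge> 1"
  shows "\<exists>F :: complex \<times> complex \<Rightarrow> complex.
    holomorphic2_on F {(a, b). a \<noteq> b} \<and>
    (\<forall>a b :: real. a < b \<longrightarrow>
      (\<forall>\<Gamma>a \<Gamma>b. contours a b \<Gamma>a \<Gamma>b \<longrightarrow>
        F (complex_of_real a, complex_of_real b) = kernel_K m \<xi>1 \<xi>2 a b \<Gamma>a \<Gamma>b)) \<and>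
    (\<forall>a b :: real. b < a \<longrightarrow>
      (\<forall>L la L' lb. contours_tilde a b L la L' lb \<longrightarrow>
        F (complex_of_real a, complex_of_real b) = kernel_K_tilde m \<xi>1 \<xi>2 a b L la L' lb))"
proof (intro exI[of _ "kernel_continuation m \<xi>1 \<xi>2"] conjI allI impI)
  have "open {x :: complex \<times> complex. fst x \<noteq> snd x}"
    by (intro open_Collect_neq continuous_intros)
  then show "holomorphic2_on (kernel_continuation m \<xi>1 \<xi>2) {(a, b). a \<noteq> b}"
    using kernel_continuation_differentiable
    unfolding holomorphic2_on_def differentiable2_def by (simp add: case_prod_unfold)
qed (simp_all only: kernel_K_eq kernel_K_tilde_eq)

end
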